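(* Let $K$ be a field, let $P=K[x_1,\dots,x_n]$, $X=(x_1,\dots,x_n)$, $\mathfrak{M}=\langle x_1,\dots,x_n\rangle$, and let $I=\langle f_1,\dots,f_r\rangle$ be an ideal of $P$ with $f_i\in\mathfrak{M}$ such that each linear part $\ell_i=\mathrm{Lin}_{\mathfrak{M}}(f_i)$ is of the form $\ell_i=a_i x_{i_1}+b_i x_{i_2}$ with $a_i,b_i\in K$ and $i_1,i_2\in\{1,\dots,n\}$. Let $E_0$ be the trivial cotangent equivalence class and let $E_1,\dots,E_q$ be the proper cotangent equivalence classes in $X$. Let $I_L=\langle\mathrm{Lin}_{\mathfrak{M}}(I)\rangle$ be the ideal generated by the linear parts of the polynomials in $I$. (a) Let $\sigma$ be a term ordering on $\mathbb{T}^n$. Then $S_\sigma=E_0\cup E_1^\sigma\cup\cdots\cup E_q^\sigma$, and hence $\#S_\sigma=\#E_0+\sum_{i=1}^q\#E_i-q$. (b) For $i=1,\dots,q$, let $E_i^\ast$ be a set obtained from $E_i$ by deleting one of its elements. Then there exists a term ordering $\sigma$ on $\mathbb{T}^n$ such that $S_\sigma=E_0\cup E_1^\ast\cup\cdots\cup E_q^\ast$. (c) Let $\Sigma$ be the set of all sets of the form $E_0\cup E_1^\ast\cup\cdots\cup E_q^\ast$, where $E_i^\ast$ is obtained from the set $E_i$ by deleting one of its elements. Then the map $\varphi:\mathrm{LTGFan}(I_L)\longrightarrow\Sigma$ given by $\varphi(S_\sigma)=E_0\cup E_1^\sigma\cup\cdots\cup E_q^\sigma$ is well-defined and bijective. (d)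 We have $\#\mathrm{LTGFan}(I_L)=\#\mathrm{GFan}(I_L)=\prod_{i=1}^q\#E_i$.
   Context: $\mathbb{T}^n$ is the monoid of terms in $x_1,\dots,x_n$. For $f\in\mathfrak{M}$, $\mathrm{Lin}_{\mathfrak{M}}(f)$ is the homogeneous component of $f$ of standard degree $1$, and $\mathrm{Lin}_{\mathfrak{M}}(I)=\langle\mathrm{Lin}_{\mathfrak{M}}(f)\mid f\in I\rangle_K$, which equals $\langle\ell_1,\dots,\ell_r\rangle_K$. Let $R=P/I$, let $\mathfrak{m}$ be the image of $\mathfrak{M}$ in $R$, and for $x_i\in X$ let $\bar x_i$ be its residue class in the cotangent space $\mathfrak{m}/\mathfrak{m}^2$ (which is isomorphic to $P_1/\mathrm{Lin}_{\mathfrak{M}}(I)$, with $P_1$ the degree one component of $P$). Cotangent equivalence is the equivalence relation on $X$ defined by $x_i\sim x_j\Leftrightarrow\langle\bar x_i\rangle_K=\langle\bar x_j\rangle_K$. An indeterminate $x_i$ is trivial if $\bar x_i=0$; the trivial indeterminates form the (possibly empty) trivial cotangent equivalence class. A non-trivial indeterminate and its class are called basic if the class consists only of $x_i$, and proper if the class contains at least two elements. For a proper equivalence class $E=\{x_{i_1},\dots,x_{i_p}\}$ and a term ordering $\sigma$ with $x_{i_1}>_\sigma\cdots>_\sigma x_{i_p}$, the $\sigma$-leading set of $E$ is $E^\sigma=E\setminus\{x_{i_p}\}$. For a term ordering $\sigma$, $S_\sigma$ denotes the unique minimal set of indeterminates generating the leading term ideal $\mathrm{LT}_\sigma(I_L)$.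 A marked reduced Gröbner basis of an ideal $J$ is a set of pairs $\{(\mathrm{LT}_\sigma(g_1),g_1),\dots,(\mathrm{LT}_\sigma(g_k),g_k)\}$ where $\sigma$ is a term ordering and $\{g_1,\dots,g_k\}$ is the reduced $\sigma$-Gröbner basis of $J$. $\mathrm{GFan}(J)$ is the set of all marked reduced Gröbner bases of $J$, and $\mathrm{LTGFan}(J)$ is the set of all their leading term sets $\{\mathrm{LT}_\sigma(g_1),\dots,\mathrm{LT}_\sigma(g_k)\}$; thus $\mathrm{LTGFan}(I_L)=\{S_\sigma\mid\sigma\text{ a term ordering}\}$. *)

theory Defs
  imports
    "HOL-Library.Poly_Mapping"
    "HOL-Algebra.QuotRing"
    "HOL-Algebra.Ideal_Product"
    "HOL-Algebra.Algebraic_Closure_Type"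
begin

section \<open>Terms and polynomials\<close>

text \<open>
  The finite index type \<open>'n\<close> plays the role of \<open>{1,\<dots>,n}\<close>.  A term is its exponent vector, so that
  the monoid of terms is written additively (\<open>0\<close> is the term 1), and a polynomial is
  a finitely supported map from terms to coefficients.
\<close>

type_synonym 'n trm = "'n \<Rightarrow>\<^sub>0 nat"
type_synonym ('n, 'k) mpoly = "'n trm \<Rightarrow>\<^sub>0 'k"

abbreviation supp :: "('n, 'k::zero) mpoly \<Rightarrow> 'n trm set" where
  "supp \<equiv> Poly_Mapping.keys"

abbreviation coeff :: "('n, 'k::zero) mpoly \<Rightarrow> 'n trm \<Rightarrow> 'k" where
  "coeff \<equiv> Poly_Mapping.lookup"

definition const_poly :: "'k::field \<Rightarrow> ('n, 'k) mpoly" where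
  "const_poly c = Poly_Mapping.single 0 c"

definition term_poly :: "'n trm \<Rightarrow> ('n, 'k::field) mpoly" where
  "term_poly t = Poly_Mapping.single t 1"

definition indet :: "'n \<Rightarrow> 'n trm" where
  "indet i = Poly_Mapping.single i 1"

definition indets :: "'n trm set" where
  "indets = range indet"

definition indet_poly :: "'n \<Rightarrow> ('n, 'k::field) mpoly" where
  "indet_poly i = term_poly (indet i)"

abbreviation poly_ring :: "('n, 'k::field) mpoly ring" where
  "poly_ring \<equiv> ring_of_type_algebra"

definition ideal_gen :: "('n, 'k::field) mpoly set \<Rightarrow> ('n, 'k) mpoly set" where
  "ideal_gen F = Idl\<^bsub>poly_ring\<^esub> F"

definition max_ideal :: "('n, 'k::field) mpoly set" where
  "max_ideal = ideal_gen (range indet_poly)"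


section \<open>Linear parts\<close>

definition trm_deg :: "'n::finite trm \<Rightarrow> nat" where
  "trm_deg t = (\<Sum>i\<in>UNIV. Poly_Mapping.lookup t i)"

definition hom_component :: "nat \<Rightarrow> ('n::finite, 'k::field) mpoly \<Rightarrow> ('n, 'k) mpoly" where
  "hom_component d f = (\<Sum>t\<in>{t \<in> supp f. trm_deg t = d}. Poly_Mapping.single t (coeff f t))"

definition lin :: "('n::finite, 'k::field) mpoly \<Rightarrow> ('n, 'k) mpoly" where
  "lin = hom_component 1"

definition K_span :: "('n, 'k::field) mpoly set \<Rightarrow> ('n, 'k) mpoly set" where
  "K_span = module.span (\<lambda>c p. const_poly c * p)"

definition Lin :: "('n::finite, 'k::field) mpoly set \<Rightarrow> ('n, 'k) mpoly set" where
  "Lin I = K_span (lin ` I)"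

definition lin_ideal :: "('n::finite, 'k::field) mpoly set \<Rightarrow> ('n, 'k) mpoly set" where
  "lin_ideal I = ideal_gen (Lin I)"


section \<open>Cotangent equivalence\<close>

text \<open>
  \<open>res_ring I\<close> is \<open>R = P/I\<close> and \<open>res_max I\<close> is the ideal \<open>m\<close> of \<open>R\<close>.  The cotangent space \<open>m/m\<^sup>2\<close>
  is the ideal of \<open>R/m\<^sup>2\<close> consisting of the cosets of elements of \<open>m\<close>; its \<open>K\<close>-vector space
  structure is induced by \<open>K \<rightarrow> P \<rightarrow> R \<rightarrow> R/m\<^sup>2\<close>.
\<close>

definition res_ring :: "('n, 'k::field) mpoly set \<Rightarrow> ('n, 'k) mpoly set ring" where
  "res_ring I = poly_ring Quot I"

definition res_class :: "('n, 'k::field) mpoly set \<Rightarrow> ('n, 'k) mpoly \<Rightarrow> ('n, 'k) mpoly set" where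
  "res_class I p = I +>\<^bsub>poly_ring\<^esub> p"

definition res_max :: "('n, 'k::field) mpoly set \<Rightarrow> ('n, 'k) mpoly set set" where
  "res_max I = res_class I ` max_ideal"

definition res_max_sq :: "('n, 'k::field) mpoly set \<Rightarrow> ('n, 'k) mpoly set set" where
  "res_max_sq I = ideal_prod (res_ring I) (res_max I) (res_max I)"

definition res_ring2 :: "('n, 'k::field) mpoly set \<Rightarrow> ('n, 'k) mpoly set set ring" where
  "res_ring2 I = res_ring I Quot res_max_sq I"

definition res_class2 :: "('n, 'k::field) mpoly set \<Rightarrow> ('n, 'k) mpoly \<Rightarrow> ('n, 'k) mpoly set set" where
  "res_class2 I p = res_max_sq I +>\<^bsub>res_ring I\<^esub> res_class I p"

definition cot_scale ::
  "('n, 'k::field) mpoly set \<Rightarrow> 'k \<Rightarrow> ('n, 'k) mpoly set set \<Rightarrow> ('n, 'k) mpoly set set" where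
  "cot_scale I c v = res_class2 I (const_poly c) \<otimes>\<^bsub>res_ring2 I\<^esub> v"

definition cot_line :: "('n, 'k::field) mpoly set \<Rightarrow> ('n, 'k) mpoly set set \<Rightarrow> ('n, 'k) mpoly set set set" where
  "cot_line I v = {cot_scale I c v | c. True}"

text \<open>In the following definitions \<open>x\<close> and \<open>y\<close> are indeterminates.\<close>

definition cot_class :: "('n, 'k::field) mpoly set \<Rightarrow> 'n trm \<Rightarrow> ('n, 'k) mpoly set set" where
  "cot_class I x = res_class2 I (term_poly x)"

definition cot_equiv :: "('n, 'k::field) mpoly set \<Rightarrow> ('n trm \<times> 'n trm) set" where
  "cot_equiv I = {(x, y). x \<in> indets \<and> y \<in> indets \<and>
                          cot_line I (cot_class I x) = cot_line I (cot_class I y)}"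

definition trivial_indet :: "('n, 'k::field) mpoly set \<Rightarrow> 'n trm \<Rightarrow> bool" where
  "trivial_indet I x \<longleftrightarrow> cot_class I x = \<zero>\<^bsub>res_ring2 I\<^esub>"

definition trivial_class :: "('n, 'k::field) mpoly set \<Rightarrow> 'n trm set" where
  "trivial_class I = {x \<in> indets. trivial_indet I x}"

definition proper_classes :: "('n, 'k::field) mpoly set \<Rightarrow> 'n trm set set" where
  "proper_classes I = {E \<in> indets // cot_equiv I. (\<forall>x\<in>E. \<not> trivial_indet I x) \<and> card E \<ge> 2}"


section \<open>Term orderings and leading terms\<close>

text \<open>\<open>(s, t) \<in> \<sigma>\<close> means that \<open>s\<close> is less than or equal to \<open>t\<close> with respect to \<open>\<sigma>\<close>.\<close>

type_synonym 'n trm_rel = "('n trm \<times> 'n trm) set"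

definition term_ordering :: "'n trm_rel \<Rightarrow> bool" where
  "term_ordering \<sigma> \<longleftrightarrow> linear_order \<sigma> \<and> (\<forall>t. (0, t) \<in> \<sigma>) \<and>
     (\<forall>s t u. (s, t) \<in> \<sigma> \<longrightarrow> (s + u, t + u) \<in> \<sigma>)"

text \<open>Only meaningful for nonzero polynomials.\<close>

definition LT :: "'n trm_rel \<Rightarrow> ('n, 'k::field) mpoly \<Rightarrow> 'n trm" where
  "LT \<sigma> f = (THE t. t \<in> supp f \<and> (\<forall>s\<in>supp f. (s, t) \<in> \<sigma>))"

definition LT_set :: "'n trm_rel \<Rightarrow> ('n, 'k::field) mpoly set \<Rightarrow> 'n trm set" where
  "LT_set \<sigma> J = LT \<sigma> ` (J - {0})"

text \<open>
  Monomial ideals are taken in \<open>K[x\<^sub>1,\<dots>,x\<^sub>n]\<close>; the first argument only fixes the field \<open>K\<close>.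
\<close>

definition term_ideal :: "'k::field itself \<Rightarrow> 'n trm set \<Rightarrow> ('n, 'k) mpoly set" where
  "term_ideal K T = ideal_gen (term_poly ` T)"

definition LT_ideal :: "'n trm_rel \<Rightarrow> ('n, 'k::field) mpoly set \<Rightarrow> ('n, 'k) mpoly set" where
  "LT_ideal \<sigma> J = term_ideal TYPE('k) (LT_set \<sigma> J)"

definition min_generates :: "'n trm set \<Rightarrow> ('n, 'k::field) mpoly set \<Rightarrow> bool" where
  "min_generates T J \<longleftrightarrow> term_ideal TYPE('k) T = J \<and> (\<forall>T'. T' \<subset> T \<longrightarrow> term_ideal TYPE('k) T' \<noteq> J)"

text \<open>For \<open>J = I\<^sub>L\<close> the following is the set \<open>S\<^sub>\<sigma>\<close>.\<close>

definition S_set :: "'n trm_rel \<Rightarrow> ('n, 'k::field) mpoly set \<Rightarrow> 'n trm set" where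
  "S_set \<sigma> J = (THE S. S \<subseteq> indets \<and> min_generates S (LT_ideal \<sigma> J))"

definition leading_set :: "'n trm_rel \<Rightarrow> 'n trm set \<Rightarrow> 'n trm set" where
  "leading_set \<sigma> E = E - {THE x. x \<in> E \<and> (\<forall>y\<in>E. (x, y) \<in> \<sigma>)}"


section \<open>Reduced Groebner bases and Groebner fans\<close>

definition groebner_basis ::
  "'n trm_rel \<Rightarrow> ('n, 'k::field) mpoly set \<Rightarrow> ('n, 'k) mpoly set \<Rightarrow> bool" where
  "groebner_basis \<sigma> J G \<longleftrightarrow> finite G \<and> G \<subseteq> J - {0} \<and>
     term_ideal TYPE('k) (LT \<sigma> ` G) = LT_ideal \<sigma> J"

definition reduced_groebner_basis ::
  "'n trm_rel \<Rightarrow> ('n, 'k::field) mpoly set \<Rightarrow> ('n, 'k) mpoly set \<Rightarrow> bool" where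
  "reduced_groebner_basis \<sigma> J G \<longleftrightarrow> groebner_basis \<sigma> J G \<and>
     (\<forall>g\<in>G. coeff g (LT \<sigma> g) = 1) \<and>
     min_generates (LT \<sigma> ` G) (LT_ideal \<sigma> J) \<and>
     (\<forall>g\<in>G. supp (g - term_poly (LT \<sigma> g)) \<inter> LT_set \<sigma> J = {})"

definition marked :: "'n trm_rel \<Rightarrow> ('n, 'k::field) mpoly set \<Rightarrow> ('n trm \<times> ('n, 'k) mpoly) set" where
  "marked \<sigma> G = (\<lambda>g. (LT \<sigma> g, g)) ` G"

definition GFan :: "('n, 'k::field) mpoly set \<Rightarrow> ('n trm \<times> ('n, 'k) mpoly) set set" where
  "GFan J = {marked \<sigma> G | \<sigma> G. term_ordering \<sigma> \<and> reduced_groebner_basis \<sigma> J G}"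

definition LTGFan :: "('n, 'k::field) mpoly set \<Rightarrow> 'n trm set set" where
  "LTGFan J = (\<lambda>M. fst ` M) ` GFan J"

end

theory Submission
  imports Defs
begin

text \<open>
  Modulo \<open>m\<^sup>2\<close> only linear parts matter, so \<open>x\<^sub>i\<close> is trivial iff \<open>x\<^sub>i \<in> L = Lin I\<close>, and \<open>x\<^sub>i \<sim> x\<^sub>j\<close> iff each
  of the two is congruent to a scalar multiple of the other modulo \<open>L\<close>.
  Fix a term ordering \<open>\<sigma>\<close>.  Sending each trivial indeterminate to \<open>0\<close> and every other \<open>x\<^sub>i\<close> to the
  multiple of the \<open>\<sigma>\<close>-least element of its class to which it is congruent defines an endomorphism \<open>\<Phi>\<close>
  of the polynomial ring.  It kills each generator \<open>a x\<^sub>i + b x\<^sub>j\<close> of \<open>L\<close>: if both indeterminates are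
  non-trivial and \<open>a, b \<noteq> 0\<close>, they are equivalent, and the image is a multiple of a single
  indeterminate outside \<open>L\<close> that lies in \<open>L\<close>, hence \<open>0\<close>.  So \<open>\<Phi>\<close> kills \<open>I\<^sub>L\<close>.  Since \<open>\<Phi>\<close> never increases
  terms and fixes those free of trivial and of non-least indeterminates, every leading term of \<open>I\<^sub>L\<close>
  is divisible by such an indeterminate, and the polynomials \<open>x\<^sub>i - \<Phi> x\<^sub>i\<close> for these \<open>x\<^sub>i\<close> form the reduced
  Groebner basis.  Any choice of least elements is realised by a lexicographic ordering.
\<close>

section \<open>The polynomial ring and its ideals\<close>

lemma poly_ring_simps:
  "carrier poly_ring = UNIV" "x \<otimes>\<^bsub>poly_ring\<^esub> y = x * y" "x \<oplus>\<^bsub>poly_ring\<^esub> y = x + y"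
  "\<zero>\<^bsub>poly_ring\<^esub> = 0" "\<one>\<^bsub>poly_ring\<^esub> = 1"
  by (auto simp: ring_of_type_algebra_def)

lemma ring_poly_ring: "ring (poly_ring :: ('n, 'k::field) mpoly ring)"
  by (rule ring_from_type_algebra)

lemma poly_ring_minus:
  fixes x y :: "('n, 'k::field) mpoly"
  shows "x \<ominus>\<^bsub>poly_ring\<^esub> y = x - y"
proof -
  interpret R: ring "poly_ring :: ('n, 'k) mpoly ring" by (rule ring_poly_ring)
  have "\<ominus>\<^bsub>poly_ring\<^esub> y = - y"
    using R.minus_equality[of "- y" y] by (simp add: poly_ring_simps)
  then show ?thesis by (simp add: a_minus_def poly_ring_simps)
qed

text \<open>Negation is covered by \<open>- p = (- 1) * p\<close>, and by commutativity closure
  under left multiplication is enough.\<close>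

lemma ideal_poly_ring_iff:
  fixes A :: "('n, 'k::field) mpoly set"
  shows "ideal A poly_ring \<longleftrightarrow>
    0 \<in> A \<and> (\<forall>p\<in>A. \<forall>q\<in>A. p + q \<in> A) \<and> (\<forall>p\<in>A. \<forall>h. h * p \<in> A)" (is "_ = ?rhs")
proof
  assume "ideal A poly_ring"
  then interpret ideal A poly_ring .
  show ?rhs
    using additive_subgroup.zero_closed[OF is_additive_subgroup]
      additive_subgroup.a_closed[OF is_additive_subgroup] I_l_closed
    by (simp add: poly_ring_simps)
next
  assume *: ?rhs
  interpret R: ring "poly_ring :: ('n, 'k) mpoly ring" by (rule ring_poly_ring)
  show "ideal A poly_ring"
  proof (rule idealI)
    show "subgroup A (add_monoid poly_ring)"
    proof (rule R.add.subgroupI)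
      fix a assume "a \<in> A"
      with * have "(- 1) * a \<in> A" by blast
      then show "\<ominus>\<^bsub>poly_ring\<^esub> a \<in> A"
        using R.minus_equality[of "- a" a] by (simp add: poly_ring_simps)
    qed (use * in \<open>auto simp: poly_ring_simps\<close>)
  qed (use * in \<open>auto simp: poly_ring_simps R.ring_axioms mult.commute\<close>)
qed

lemma ideal_ideal_gen: "ideal (ideal_gen F) (poly_ring :: ('n, 'k::field) mpoly ring)"
  unfolding ideal_gen_def by (rule ring.genideal_ideal[OF ring_poly_ring]) (simp add: poly_ring_simps)

lemma ideal_gen_superset: "F \<subseteq> ideal_gen F"
  unfolding ideal_gen_def by (rule ring.genideal_self[OF ring_poly_ring]) (simp add: poly_ring_simps)

lemma ideal_gen_minimal: "ideal A poly_ring \<Longrightarrow> F \<subseteq> A \<Longrightarrow> ideal_gen F \<subseteq> A"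
  unfolding ideal_gen_def by (rule ring.genideal_minimal[OF ring_poly_ring])

lemma ideal_poly_ringD:
  assumes "ideal A (poly_ring :: ('n, 'k::field) mpoly ring)"
  shows ideal_zero: "0 \<in> A"
    and ideal_add: "p \<in> A \<Longrightarrow> q \<in> A \<Longrightarrow> p + q \<in> A"
    and ideal_mult: "p \<in> A \<Longrightarrow> h * p \<in> A"
    and ideal_uminus: "p \<in> A \<Longrightarrow> - p \<in> A"
    and ideal_diff: "p \<in> A \<Longrightarrow> q \<in> A \<Longrightarrow> p - q \<in> A"
proof -
  from assms have *: "0 \<in> A" "\<And>p q. p \<in> A \<Longrightarrow> q \<in> A \<Longrightarrow> p + q \<in> A" "\<And>p h. p \<in> A \<Longrightarrow> h * p \<in> A"
    unfolding ideal_poly_ring_iff by blast+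
  have u: "- p \<in> A" if "p \<in> A" for p
    using *(3)[OF that, of "- 1"] by simp
  show "0 \<in> A" "p \<in> A \<Longrightarrow> q \<in> A \<Longrightarrow> p + q \<in> A" "p \<in> A \<Longrightarrow> h * p \<in> A" "p \<in> A \<Longrightarrow> - p \<in> A"
    using * u by blast+
  show "p - q \<in> A" if "p \<in> A" "q \<in> A"
    using *(2)[OF that(1) u[OF that(2)]] by simp
qed

lemma mpoly_eq_sum_single:
  fixes p :: "('n, 'k::field) mpoly"
  shows "p = (\<Sum>t\<in>supp p. Poly_Mapping.single t (coeff p t))"
  by (rule poly_mapping_eqI)
    (simp add: lookup_sum lookup_single when_def sum.delta' in_keys_iff)

text \<open>Every polynomial is a finite sum of monomials. The coefficient 0 is allowed in the
  monomial case, which takes care of the zero polynomial.\<close>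

lemma mpoly_induct [case_names single add]:
  fixes p :: "('n, 'k::field) mpoly"
  assumes s: "\<And>t c. P (Poly_Mapping.single t c)"
    and a: "\<And>p q. P p \<Longrightarrow> P q \<Longrightarrow> P (p + q)"
  shows "P p"
proof -
  have "P (\<Sum>t\<in>A. Poly_Mapping.single t (coeff p t))" if "finite A" for A
    using that
  proof (induction A)
    case empty
    then show ?case using s[of 0 0] by simp
  qed (simp add: s a)
  then show ?thesis
    using mpoly_eq_sum_single[of p] by (metis finite_keys)
qed

section \<open>Terms and linear parts\<close>

lemma trm_deg_zero [simp]: "trm_deg 0 = 0"
  by (simp add: trm_deg_def)

lemma trm_deg_add [simp]: "trm_deg (s + t) = trm_deg s + trm_deg t"
  by (simp add: trm_deg_def lookup_add sum.distrib)

lemma trm_deg_indet [simp]: "trm_deg (indet i) = 1"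
  by (simp add: trm_deg_def indet_def lookup_single when_def)

lemma inj_indet: "inj indet"
  by (rule injI) (metis indet_def keys_single one_neq_zero singleton_inject)

lemma indet_eq_iff [simp]: "indet i = indet j \<longleftrightarrow> i = j"
  using inj_indet by (auto dest: injD)

lemma indet_nonzero [simp]: "indet i \<noteq> 0"
  by (metis indet_def lookup_single_eq lookup_zero one_neq_zero)

lemma indet_adds:
  assumes "Poly_Mapping.lookup t i \<noteq> 0"
  shows "\<exists>u. t = indet i + (u :: 'n trm)"
proof
  show "t = indet i + (t - indet i)"
    using assms
    by (intro poly_mapping_eqI) (auto simp: lookup_add lookup_minus indet_def lookup_single when_def)
qed

lemma nonzero_indet_adds:
  assumes "t \<noteq> 0"
  shows "\<exists>i u. t = indet i + (u :: 'n trm)"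
  using assms indet_adds by (metis poly_mapping_eqI lookup_zero)

lemma trm_deg_eq_0_iff [simp]: "trm_deg t = 0 \<longleftrightarrow> t = 0"
proof
  assume t: "trm_deg t = 0"
  show "t = 0"
  proof (rule ccontr)
    assume "t \<noteq> 0"
    then obtain i u where "t = indet i + u" using nonzero_indet_adds by blast
    then have "trm_deg t = 1 + trm_deg u" by simp
    with t show False by simp
  qed
qed simp

lemma trm_add_eq_0_iff [simp]: "s + t = 0 \<longleftrightarrow> s = 0 \<and> t = (0 :: 'n trm)"
  by (metis add_eq_0_iff_both_eq_0 add_0 lookup_add lookup_zero poly_mapping_eqI)

section \<open>Scalar multiplication and linear parts\<close>

lemma coeff_const_mult [simp]: "coeff (const_poly c * p) t = c * coeff p t"
  by (induction p rule: mpoly_induct)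
    (auto simp: const_poly_def mult_single lookup_single lookup_add when_def distrib_left)

lemma const_poly_add: "const_poly (a + b) = const_poly a + const_poly b"
  by (simp add: const_poly_def single_add)

lemma const_poly_mult: "const_poly (a * b) = const_poly a * const_poly b"
  by (simp add: const_poly_def mult_single)

lemma const_poly_1 [simp]: "const_poly 1 = 1"
  by (simp add: const_poly_def)

lemma const_poly_0 [simp]: "const_poly 0 = 0"
  by (simp add: const_poly_def)

text \<open>\<open>K_span\<close> is \<open>module.span\<close> for exactly this scalar
  multiplication, so the theory of spans and subspaces becomes applicable to it.\<close>

interpretation poly_vs: vector_space "\<lambda>c (p :: ('n, 'k::field) mpoly). const_poly c * p"
  by unfold_locales (simp_all add: algebra_simps const_poly_add const_poly_mult)

lemma coeff_hom_component [simp]: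
  "coeff (hom_component d f) t = (if trm_deg t = d then coeff f t else 0)"
  by (auto simp: hom_component_def lookup_sum lookup_single when_def in_keys_iff)

lemma coeff_lin [simp]: "coeff (lin f) t = (if trm_deg t = 1 then coeff f t else 0)"
  by (simp add: lin_def)

lemma lin_zero [simp]: "lin 0 = 0"
  by (rule poly_mapping_eqI) simp

lemma lin_add: "lin (p + q) = lin p + lin q"
  by (rule poly_mapping_eqI) (simp add: lookup_add)

lemma lin_diff: "lin (p - q) = lin p - lin q"
  by (rule poly_mapping_eqI) (simp add: lookup_minus)

lemma lin_const_mult: "lin (const_poly c * p) = const_poly c * lin p"
  by (rule poly_mapping_eqI) simp

lemma lin_lin [simp]: "lin (lin p) = lin p"
  by (rule poly_mapping_eqI) simp

lemma lin_indet_poly [simp]: "lin (indet_poly i) = indet_poly i"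
  by (rule poly_mapping_eqI) (auto simp: indet_poly_def term_poly_def lookup_single when_def)

text \<open>A sum of exponent vectors vanishes only if both summands do, so only the two constant
  terms contribute.\<close>

lemma coeff_mult_0: "coeff (p * q) 0 = coeff p 0 * coeff (q :: ('n, 'k::field) mpoly) 0"
proof (induction p rule: mpoly_induct)
  case (single s a)
  show ?case
  proof (induction q rule: mpoly_induct)
    case (single t b)
    then show ?case
      by (auto simp: mult_single lookup_single when_def)
  qed (simp add: lookup_add distrib_left)
qed (simp add: lookup_add distrib_right)

text \<open>The Leibniz rule at the origin: a product of two terms has degree 1 only if one factor
  is 1 and the other has degree 1. Both sides are bilinear, so checking monomials suffices.\<close>

lemma lin_mult: "lin (p * q) = const_poly (coeff p 0) * lin q + const_poly (coeff q 0) * lin p"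
proof (induction p rule: mpoly_induct)
  case (single s a)
  show ?case
  proof (induction q rule: mpoly_induct)
    case (single t b)
    have l: "lin (Poly_Mapping.single u c) = (if trm_deg u = 1 then Poly_Mapping.single u c else 0)"
      for u and c :: 'b
      by (rule poly_mapping_eqI) (auto simp: lookup_single when_def)
    show ?case
      by (cases "s = 0"; cases "t = 0")
        (auto simp: l mult_single const_poly_def lookup_single when_def mult.commute add_is_1)
  qed (simp add: lookup_add algebra_simps lin_add const_poly_add)
qed (simp add: lookup_add algebra_simps lin_add const_poly_add)

text \<open>The polynomials without constant term form an ideal containing all indeterminates;
  conversely, every term other than 1 is divisible by an indeterminate.\<close>

lemma max_ideal_eq: "max_ideal = {p :: ('n, 'k::field) mpoly. coeff p 0 = 0}"
proof (intro equalityI subsetI)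
  have "ideal {p :: ('n, 'k) mpoly. coeff p 0 = 0} poly_ring"
    by (auto simp: ideal_poly_ring_iff lookup_add coeff_mult_0)
  then have "max_ideal \<subseteq> {p :: ('n, 'k) mpoly. coeff p 0 = 0}"
    unfolding max_ideal_def
    by (rule ideal_gen_minimal)
       (auto simp: indet_poly_def term_poly_def lookup_single when_def)
  then show "p \<in> {p. coeff p 0 = 0}" if "p \<in> max_ideal" for p :: "('n, 'k) mpoly" using that by auto
next
  fix p :: "('n, 'k) mpoly" assume p: "p \<in> {p. coeff p 0 = 0}"
  have I: "ideal (max_ideal :: ('n, 'k) mpoly set) poly_ring"
    unfolding max_ideal_def by (rule ideal_ideal_gen)
  have mon: "Poly_Mapping.single t c \<in> max_ideal" if t: "t \<noteq> 0" for t :: "'n trm" and c :: 'k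
  proof -
    obtain i u where "t = u + indet i" using nonzero_indet_adds[OF t] by (metis add.commute)
    then have "Poly_Mapping.single t c = Poly_Mapping.single u c * indet_poly i"
      by (simp add: mult_single indet_poly_def term_poly_def)
    then show ?thesis
      using ideal_mult[OF I] ideal_gen_superset[of "range indet_poly"] unfolding max_ideal_def
      by (metis rangeI subsetD)
  qed
  have "(\<Sum>t\<in>A. Poly_Mapping.single t (coeff p t)) \<in> max_ideal" if "finite A" "A \<subseteq> supp p" for A
    using that
  proof (induction A)
    case (insert t A)
    then have "t \<noteq> 0" using p by auto
    with insert show ?case by (simp add: mon ideal_add[OF I])
  qed (simp add: ideal_zero[OF I])
  then show "p \<in> max_ideal"
    using mpoly_eq_sum_single[of p] by (metis finite_keys order_refl)
qed

text \<open>\<open>lin\<close> is \<open>K\<close>-linear, so the image of an ideal is already a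
  subspace and taking the span adds nothing.\<close>

lemma Lin_eq:
  assumes I: "ideal I (poly_ring :: ('n::finite, 'k::field) mpoly ring)"
  shows "Lin I = lin ` I"
proof -
  have "poly_vs.subspace (lin ` I)"
    unfolding poly_vs.subspace_def
  proof (safe; (intro imageI)?)
    show "0 \<in> lin ` I" using ideal_zero[OF I] lin_zero by force
    fix p q assume "p \<in> I" "q \<in> I"
    then show "lin p + lin q \<in> lin ` I"
      using ideal_add[OF I] by (metis lin_add imageI)
  next
    fix c p assume "p \<in> I"
    then show "const_poly c * lin p \<in> lin ` I"
      using ideal_mult[OF I] by (metis lin_const_mult imageI)
  qed
  then show ?thesis
    unfolding Lin_def K_span_def by (rule poly_vs.span_eq_iff[THEN iffD2])
qed

text \<open>In the product rule for \<open>h * p\<close> the summand with \<open>lin h\<close>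
  vanishes when \<open>p\<close> has no constant term, so multiplication by \<open>h\<close> merely
  scales \<open>lin p\<close>. This is why membership in \<open>max_ideal\<close> is carried along
  in the auxiliary ideal.\<close>

lemma Lin_ideal_gen:
  fixes F :: "('n::finite, 'k::field) mpoly set"
  assumes F: "F \<subseteq> max_ideal"
  shows "Lin (ideal_gen F) = K_span (lin ` F)"
proof
  have "ideal {p \<in> max_ideal. lin p \<in> K_span (lin ` F)} poly_ring"
    unfolding ideal_poly_ring_iff K_span_def
    by (auto simp: max_ideal_eq lookup_add coeff_mult_0 lin_add lin_mult
        poly_vs.span_zero poly_vs.span_add poly_vs.span_scale)
  then have "ideal_gen F \<subseteq> {p \<in> max_ideal. lin p \<in> K_span (lin ` F)}"
    by (rule ideal_gen_minimal) (use F in \<open>auto simp: K_span_def intro: poly_vs.span_base\<close>)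
  then show "Lin (ideal_gen F) \<subseteq> K_span (lin ` F)"
    unfolding Lin_eq[OF ideal_ideal_gen] by auto
  show "K_span (lin ` F) \<subseteq> Lin (ideal_gen F)"
    unfolding Lin_def K_span_def by (intro poly_vs.span_mono image_mono ideal_gen_superset)
qed

section \<open>The cotangent space\<close>

lemma coset_eq_iff:
  assumes R: "ring R" and J: "ideal J R" and "x \<in> carrier R" "y \<in> carrier R"
  shows "J +>\<^bsub>R\<^esub> x = J +>\<^bsub>R\<^esub> y \<longleftrightarrow> x \<ominus>\<^bsub>R\<^esub> y \<in> J"
  using ring.quotient_eq_iff_same_a_r_cos[OF R J] assms(3,4) by blast

context
  fixes I :: "('n::finite, 'k::field) mpoly set"
  assumes I: "ideal I poly_ring" and I_max: "I \<subseteq> max_ideal"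
begin

lemma res_ring: "ring (res_ring I)"
  unfolding res_ring_def by (rule ideal.quotient_is_ring[OF I])

lemma res_class_hom: "res_class I \<in> ring_hom poly_ring (res_ring I)"
  unfolding res_ring_def res_class_def by (rule ideal.rcos_ring_hom[OF I])

lemma res_class_carrier: "res_class I p \<in> carrier (res_ring I)"
  using ring_hom_closed[OF res_class_hom] by (simp add: poly_ring_simps)

lemma res_class_zero: "res_class I 0 = \<zero>\<^bsub>res_ring I\<^esub>"
  using ring_hom_zero[OF res_class_hom ring_poly_ring res_ring] by (simp add: poly_ring_simps)

lemma carrier_res_ring: "carrier (res_ring I) = range (res_class I)"
proof
  show "carrier (res_ring I) \<subseteq> range (res_class I)"
    by (auto simp: res_ring_def FactRing_simps res_class_def a_r_coset_def)
qed (use res_class_carrier in blast)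

lemma res_class_add: "res_class I (p + q) = res_class I p \<oplus>\<^bsub>res_ring I\<^esub> res_class I q"
  using ring_hom_add[OF res_class_hom, of p q] by (simp add: poly_ring_simps)

lemma res_class_mult: "res_class I (p * q) = res_class I p \<otimes>\<^bsub>res_ring I\<^esub> res_class I q"
  using ring_hom_mult[OF res_class_hom, of p q] by (simp add: poly_ring_simps)

lemma res_class_minus: "res_class I ((p :: ('n, 'k) mpoly) - q) = res_class I p \<ominus>\<^bsub>res_ring I\<^esub> res_class I q"
proof -
  interpret R: ring "res_ring I" by (rule res_ring)
  have "res_class I p = res_class I (p - q) \<oplus>\<^bsub>res_ring I\<^esub> res_class I q"
    by (simp flip: res_class_add)
  then show ?thesis
    by (simp add: R.minus_eq R.a_assoc R.r_neg res_class_carrier)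
qed

lemma res_class_eq_iff: "res_class I p = res_class I q \<longleftrightarrow> p - q \<in> I"
  unfolding res_class_def
  by (subst coset_eq_iff[OF ring_poly_ring I]) (simp_all add: poly_ring_simps poly_ring_minus)

lemma ideal_res_max: "ideal (res_max I) (res_ring I)"
proof (rule idealI[OF res_ring])
  interpret R: ring "res_ring I" by (rule res_ring)
  have M: "ideal max_ideal (poly_ring :: ('n, 'k) mpoly ring)"
    unfolding max_ideal_def by (rule ideal_ideal_gen)
  show "subgroup (res_max I) (add_monoid (res_ring I))"
  proof (rule R.add.subgroupI)
    show "res_max I \<subseteq> carrier (res_ring I)" "res_max I \<noteq> {}"
      using ideal_zero[OF M] by (auto simp: res_max_def res_class_carrier)
    fix a b assume "a \<in> res_max I" "b \<in> res_max I"
    then obtain p q where pq: "a = res_class I p" "b = res_class I q" "p \<in> max_ideal" "q \<in> max_ideal"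
      by (auto simp: res_max_def)
    have "\<ominus>\<^bsub>res_ring I\<^esub> a = res_class I (- p)"
      by (rule R.minus_equality)
        (simp_all add: pq res_class_carrier flip: res_class_add res_class_zero)
    then show "\<ominus>\<^bsub>res_ring I\<^esub> a \<in> res_max I"
      using pq ideal_uminus[OF M] by (simp add: res_max_def)
    show "a \<oplus>\<^bsub>res_ring I\<^esub> b \<in> res_max I"
      using pq ideal_add[OF M] by (simp add: res_max_def flip: res_class_add)
  qed
next
  fix a x assume "a \<in> res_max I" "x \<in> carrier (res_ring I)"
  then obtain p q where pq: "a = res_class I p" "x = res_class I q" "p \<in> max_ideal"
    by (auto simp: res_max_def carrier_res_ring)
  have M: "ideal max_ideal (poly_ring :: ('n, 'k) mpoly ring)"
    unfolding max_ideal_def by (rule ideal_ideal_gen)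
  show "x \<otimes>\<^bsub>res_ring I\<^esub> a \<in> res_max I" "a \<otimes>\<^bsub>res_ring I\<^esub> x \<in> res_max I"
    using pq ideal_mult[OF M, of p q] by (simp_all add: res_max_def mult.commute flip: res_class_mult)
qed

lemma ideal_res_max_sq: "ideal (res_max_sq I) (res_ring I)"
  unfolding res_max_sq_def
  by (rule ring.ideal_prod_is_ideal[OF res_ring ideal_res_max ideal_res_max])

lemma res_class2_eq_iff: "res_class2 I p = res_class2 I q \<longleftrightarrow> res_class I (p - q) \<in> res_max_sq I"
  unfolding res_class2_def
  by (subst coset_eq_iff[OF res_ring ideal_res_max_sq]) (simp_all add: res_class_carrier res_class_minus)

lemma cot_scale_res_class2: "cot_scale I c (res_class2 I p) = res_class2 I (const_poly c * p)"
proof -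
  have hom: "(+>\<^bsub>res_ring I\<^esub>) (res_max_sq I) \<in> ring_hom (res_ring I) (res_ring2 I)"
    unfolding res_ring2_def by (rule ideal.rcos_ring_hom[OF ideal_res_max_sq])
  show ?thesis
    unfolding cot_scale_def res_class2_def
    by (simp add: ring_hom_mult[OF hom] res_class_carrier res_class_mult)
qed

lemma zero_res_ring2: "\<zero>\<^bsub>res_ring2 I\<^esub> = res_class2 I 0"
proof -
  have hom: "(+>\<^bsub>res_ring I\<^esub>) (res_max_sq I) \<in> ring_hom (res_ring I) (res_ring2 I)"
    unfolding res_ring2_def by (rule ideal.rcos_ring_hom[OF ideal_res_max_sq])
  have "ring (res_ring2 I)"
    unfolding res_ring2_def by (rule ideal.quotient_is_ring[OF ideal_res_max_sq])
  from ring_hom_zero[OF hom res_ring this] show ?thesis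
    by (simp add: res_class2_def res_class_zero)
qed

text \<open>A product of two polynomials without constant term has no linear part. Representatives
  of one residue class differ by an element of \<open>I\<close>, whose linear part lies in
  \<open>Lin I\<close>; hence the induction runs over arbitrary representatives
  \<open>p\<close>.\<close>

lemma res_max_sq_imp_lin:
  assumes "v \<in> res_max_sq I" "v = res_class I p"
  shows "lin p \<in> Lin I"
  using assms[unfolded res_max_sq_def]
proof (induction arbitrary: p rule: ideal_prod.induct)
  case (prod i j)
  then obtain a b where ab: "i = res_class I a" "j = res_class I b" "coeff a 0 = 0" "coeff b 0 = 0"
    by (auto simp: res_max_def max_ideal_eq)
  then have "p - a * b \<in> I"
    using prod by (simp flip: res_class_mult res_class_eq_iff)
  then have "lin (p - a * b) \<in> Lin I"
    unfolding Lin_eq[OF I] by blast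
  then show ?case using ab by (simp add: lin_diff lin_mult)
next
  case (sum s1 s2)
  have R: "ring (res_ring I)" by (rule res_ring)
  obtain a b where ab: "s1 = res_class I a" "s2 = res_class I b"
    using ring.ideal_prod_in_carrier[OF R ideal_res_max ideal_res_max] sum.hyps
    unfolding carrier_res_ring by blast
  have "p - (a + b) \<in> I"
    using sum.prems ab by (simp flip: res_class_add res_class_eq_iff)
  then have "lin (p - (a + b)) \<in> Lin I"
    unfolding Lin_eq[OF I] by blast
  moreover have "lin a \<in> Lin I" "lin b \<in> Lin I"
    using sum.IH ab by auto
  ultimately have "lin (p - (a + b)) + (lin a + lin b) \<in> Lin I"
    unfolding Lin_def K_span_def by (intro poly_vs.span_add)
  then show ?case by (simp add: lin_diff lin_add)
qed

text \<open>Splitting an indeterminate off a term of degree at least 2 leaves a cofactor other than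
  1, so each monomial is a product of two elements of \<open>max_ideal\<close>.\<close>

lemma deg_ge_2_imp_res_max_sq:
  assumes "\<forall>t\<in>supp p. trm_deg t \<ge> 2"
  shows "res_class I p \<in> res_max_sq I"
proof -
  have zero: "res_class I 0 \<in> res_max_sq I"
    using additive_subgroup.zero_closed[OF ideal.axioms(1)[OF ideal_res_max_sq]]
    by (simp add: res_class_zero)
  have mon: "res_class I (Poly_Mapping.single t c) \<in> res_max_sq I" if t: "trm_deg t \<ge> 2" for t c
  proof -
    obtain i u where iu: "t = indet i + u" using nonzero_indet_adds[of t] t by force
    with t have "u \<noteq> 0" by auto
    with iu have "Poly_Mapping.single t c = indet_poly i * Poly_Mapping.single u c"
      "indet_poly i \<in> (max_ideal :: ('n, 'k) mpoly set)"
      "Poly_Mapping.single u c \<in> (max_ideal :: ('n, 'k) mpoly set)"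
      by (auto simp: mult_single indet_poly_def term_poly_def max_ideal_eq lookup_single when_def)
    then show ?thesis
      unfolding res_max_sq_def res_max_def by (auto simp: res_class_mult intro!: ideal_prod.prod)
  qed
  have "res_class I (\<Sum>t\<in>A. Poly_Mapping.single t (coeff p t)) \<in> res_max_sq I"
    if "finite A" "A \<subseteq> supp p" for A
    using that
  proof (induction A)
    case (insert t A)
    with assms show ?case
      unfolding res_max_sq_def by (auto simp: res_class_add intro!: ideal_prod.sum mon[unfolded res_max_sq_def])
  qed (simp add: zero)
  then show ?thesis
    using mpoly_eq_sum_single[of p] by (metis finite_keys order_refl)
qed

text \<open>The isomorphism of the cotangent space with \<open>P\<^sub>1 / Lin I\<close>, in the
  form of a membership test for linear forms.\<close>

lemma res_max_sq_iff_Lin: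
  assumes p: "lin p = p"
  shows "res_class I p \<in> res_max_sq I \<longleftrightarrow> p \<in> Lin I"
proof
  assume "p \<in> Lin I"
  then obtain g where g: "g \<in> I" "p = lin g" by (auto simp: Lin_eq[OF I])
  then have g0: "coeff g 0 = 0" using I_max by (auto simp: max_ideal_eq)
  \<comment> \<open>Degree 1 cancels by construction, and degree 0 is absent because
    \<open>g\<close> lies in the maximal ideal.\<close>
  have "\<forall>t\<in>supp (lin g - g). trm_deg t \<ge> 2"
  proof
    fix t assume "t \<in> supp (lin g - g)"
    then have "coeff (lin g - g) t \<noteq> 0" by (simp add: in_keys_iff)
    then have "trm_deg t \<noteq> 1" "t \<noteq> 0" using g0 by (auto simp: lookup_minus split: if_splits)
    moreover from \<open>t \<noteq> 0\<close> have "trm_deg t \<noteq> 0" by simp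
    ultimately show "trm_deg t \<ge> 2" by linarith
  qed
  then have "res_class I (lin g - g) \<in> res_max_sq I" by (rule deg_ge_2_imp_res_max_sq)
  moreover have "res_class I (lin g - g) = res_class I p"
    using g ideal_uminus[OF I] by (simp add: res_class_eq_iff)
  ultimately show "res_class I p \<in> res_max_sq I" by simp
qed (use res_max_sq_imp_lin p in force)

lemma trivial_indet_iff: "trivial_indet I (indet i) \<longleftrightarrow> indet_poly i \<in> Lin I"
  using res_max_sq_iff_Lin[of "indet_poly i"]
  by (simp add: trivial_indet_def cot_class_def zero_res_ring2 res_class2_eq_iff flip: indet_poly_def)

lemma cot_line_indet: "cot_line I (cot_class I (indet i)) = range (\<lambda>c. res_class2 I (const_poly c * indet_poly i))"
  by (auto simp: cot_line_def cot_class_def cot_scale_res_class2 simp flip: indet_poly_def)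

lemma res_class2_indet_eq_iff:
  "res_class2 I (const_poly a * indet_poly i) = res_class2 I (const_poly b * indet_poly j) \<longleftrightarrow>
   const_poly a * indet_poly i - const_poly b * indet_poly j \<in> Lin I"
  unfolding res_class2_eq_iff by (rule res_max_sq_iff_Lin) (simp add: lin_diff lin_const_mult)

text \<open>A line lies in another as soon as its spanning vector does, since a congruence modulo
  \<open>Lin I\<close> may be multiplied by any scalar. The value \<open>c = 0\<close> accounts for
  a trivial indeterminate on the left.\<close>

lemma cot_line_subset_iff:
  "cot_line I (cot_class I (indet i)) \<subseteq> cot_line I (cot_class I (indet j)) \<longleftrightarrow>
   (\<exists>c. indet_poly i - const_poly c * indet_poly j \<in> Lin I)"
proof
  assume "cot_line I (cot_class I (indet i)) \<subseteq> cot_line I (cot_class I (indet j))"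
  then have "res_class2 I (const_poly 1 * indet_poly i) \<in> range (\<lambda>c. res_class2 I (const_poly c * indet_poly j))"
    unfolding cot_line_indet by blast
  then obtain c where "res_class2 I (const_poly 1 * indet_poly i) = res_class2 I (const_poly c * indet_poly j)"
    by blast
  then show "\<exists>c. indet_poly i - const_poly c * indet_poly j \<in> Lin I"
    unfolding res_class2_indet_eq_iff by auto
next
  assume "\<exists>c. indet_poly i - const_poly c * indet_poly j \<in> Lin I"
  then obtain c where c: "indet_poly i - const_poly c * indet_poly j \<in> Lin I" by blast
  have eq: "res_class2 I (const_poly a * indet_poly i) = res_class2 I (const_poly (a * c) * indet_poly j)" for a
  proof -
    have "const_poly a * (indet_poly i - const_poly c * indet_poly j) \<in> Lin I"
      using c unfolding Lin_def K_span_def by (rule poly_vs.span_scale)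
    then show ?thesis
      unfolding res_class2_indet_eq_iff by (simp only: const_poly_mult right_diff_distrib mult.assoc)
  qed
  show "cot_line I (cot_class I (indet i)) \<subseteq> cot_line I (cot_class I (indet j))"
    unfolding cot_line_indet using eq by blast
qed

lemma cot_equiv_indet_iff:
  "(indet i, indet j) \<in> cot_equiv I \<longleftrightarrow>
   (\<exists>c. indet_poly i - const_poly c * indet_poly j \<in> Lin I) \<and>
   (\<exists>c. indet_poly j - const_poly c * indet_poly i \<in> Lin I)"
  unfolding cot_line_subset_iff[symmetric] by (simp add: cot_equiv_def indets_def set_eq_subset)

end

section \<open>Monomial ideals\<close>

text \<open>Divisibility of terms in additive notation; it reduces questions about monomial ideals
  to sets of exponent vectors.\<close>

definition multiples :: "'n trm set \<Rightarrow> 'n trm set" where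
  "multiples T = {s + u | s u. s \<in> T}"

lemma multiplesI: "s \<in> T \<Longrightarrow> s + u \<in> multiples T"
  by (auto simp: multiples_def)

lemma multiples_superset: "T \<subseteq> multiples T"
  using multiplesI[of _ T 0] by auto

lemma multiples_add: "t \<in> multiples T \<Longrightarrow> t + u \<in> multiples T"
  by (auto simp: multiples_def) (metis add.assoc)

lemma multiples_least:
  assumes "T \<subseteq> multiples T'"
  shows "multiples T \<subseteq> multiples T'"
  using assms multiples_add by (fastforce simp: multiples_def[of T])

text \<open>A polynomial lies in a monomial ideal iff each of its terms does. The right-hand side is
  an ideal because terms of sums and products come from terms of the operands.\<close>

lemma term_ideal_eq:
  "term_ideal TYPE('k::field) T = {p :: ('n, 'k) mpoly. supp p \<subseteq> multiples T}"
proof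
  have "ideal {p :: ('n, 'k) mpoly. supp p \<subseteq> multiples T} poly_ring"
    unfolding ideal_poly_ring_iff
  proof (safe)
    fix p q :: "('n, 'k) mpoly" and t
    assume "supp p \<subseteq> multiples T" "supp q \<subseteq> multiples T" "t \<in> supp (p + q)"
    then show "t \<in> multiples T" using keys_add[of p q] by blast
  next
    fix p h :: "('n, 'k) mpoly" and t
    assume p: "supp p \<subseteq> multiples T" and "t \<in> supp (h * p)"
    then obtain a b where "t = a + b" "b \<in> supp p" using keys_mult[of h p] by blast
    then show "t \<in> multiples T" using p multiples_add[of b T a] by (auto simp: add.commute)
  qed simp
  then show "term_ideal TYPE('k) T \<subseteq> {p. supp p \<subseteq> multiples T}"
    unfolding term_ideal_def
    by (rule ideal_gen_minimal) (auto simp: term_poly_def intro: subsetD[OF multiples_superset])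
  have I: "ideal (term_ideal TYPE('k) T) poly_ring"
    unfolding term_ideal_def by (rule ideal_ideal_gen)
  show "{p. supp p \<subseteq> multiples T} \<subseteq> term_ideal TYPE('k) T"
  proof
    fix p :: "('n, 'k) mpoly" assume p: "p \<in> {p. supp p \<subseteq> multiples T}"
    have mon: "Poly_Mapping.single t c \<in> term_ideal TYPE('k) T" if t: "t \<in> multiples T" for t c
    proof -
      obtain s u where su: "t = s + u" "s \<in> T" using t by (auto simp: multiples_def)
      then have "Poly_Mapping.single t c = Poly_Mapping.single u c * term_poly s"
        by (simp add: mult_single term_poly_def add.commute)
      moreover have "term_poly s \<in> term_ideal TYPE('k) T"
        using su ideal_gen_superset unfolding term_ideal_def by blast
      ultimately show ?thesis using ideal_mult[OF I] by metis
    qed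
    have "(\<Sum>t\<in>A. Poly_Mapping.single t (coeff p t)) \<in> term_ideal TYPE('k) T"
      if "finite A" "A \<subseteq> supp p" for A
      using that
    proof (induction A)
      case (insert t A)
      then have "t \<in> multiples T" using p by auto
      with insert show ?case by (simp add: mon ideal_add[OF I])
    qed (simp add: ideal_zero[OF I])
    then show "p \<in> term_ideal TYPE('k) T"
      using mpoly_eq_sum_single[of p] by (metis finite_keys order_refl)
  qed
qed

lemma term_ideal_eq_iff:
  "term_ideal TYPE('k::field) T = term_ideal TYPE('k) T' \<longleftrightarrow> multiples T = multiples T'"
proof
  assume eq: "term_ideal TYPE('k) T = term_ideal TYPE('k) T'"
  have "t \<in> multiples T \<longleftrightarrow> (term_poly t :: ('a, 'k) mpoly) \<in> term_ideal TYPE('k) T" for t T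
    by (simp add: term_ideal_eq term_poly_def)
  with eq show "multiples T = multiples T'" by auto
qed (simp add: term_ideal_eq)

text \<open>No indeterminate divides a different one, so an indeterminate removed from
  \<open>S\<close> is not recovered as a multiple of the others.\<close>

lemma min_generates_indets:
  assumes "S \<subseteq> indets"
  shows "min_generates S (term_ideal TYPE('k::field) S)"
  unfolding min_generates_def
proof (intro conjI allI impI refl)
  fix T' assume T': "T' \<subset> S"
  then obtain i where i: "indet i \<in> S" "indet i \<notin> T'" using assms by (auto simp: indets_def)
  have "indet i \<notin> multiples T'"
  proof
    assume "indet i \<in> multiples T'"
    then obtain t u where "indet i = t + u" "t \<in> T'" by (auto simp: multiples_def)
    moreover from this obtain j where "t = indet j" using T' assms by (auto simp: indets_def)
    ultimately have ju: "indet i = indet j + u" "indet j \<in> T'" by simp_all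
    then have "Poly_Mapping.lookup (indet i) j \<noteq> 0" by (simp add: lookup_add indet_def)
    then have "i = j" by (simp add: indet_def lookup_single when_def split: if_splits)
    with ju i show False by simp
  qed
  moreover have "indet i \<in> multiples S" using i multiples_superset by blast
  ultimately show "term_ideal TYPE('k) T' \<noteq> term_ideal TYPE('k) S"
    unfolding term_ideal_eq_iff by blast
qed

text \<open>Irreducibility of an indeterminate in the monoid of terms, written additively.\<close>

lemma indet_eq_addD: "indet i = s + u \<Longrightarrow> s = 0 \<or> s = indet i"
  for s u :: "'n trm"
proof -
  assume eq: "indet i = s + u"
  show "s = 0 \<or> s = indet i"
  proof (cases "s = 0")
    case False
    then obtain j v where s: "s = indet j + v" using nonzero_indet_adds by blast
    then have eq': "indet i = indet j + (v + u)" using eq by (simp add: add.assoc)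
    then have "Poly_Mapping.lookup (indet i) j \<noteq> 0" by (simp add: lookup_add indet_def)
    then have "i = j" by (simp add: indet_def lookup_single when_def split: if_splits)
    with eq' have "v + u = 0" by simp
    then show ?thesis using s \<open>i = j\<close> by simp
  qed simp
qed

text \<open>Each element of \<open>S\<close> is a multiple of some \<open>t\<close> in
  \<open>T\<close>. Here \<open>t\<close> is not 1, since 1 is no multiple of an indeterminate, so
  irreducibility gives \<open>S \<subseteq> T\<close>, and minimality of \<open>T\<close> excludes
  proper inclusion. \<open>T\<close> may be any set of terms, so this applies to the leading terms
  of a reduced basis too.\<close>

lemma min_generates_unique:
  assumes S: "S \<subseteq> indets" and T: "min_generates T (term_ideal TYPE('k::field) S)"
  shows "T = S"
proof -
  have m: "multiples T = multiples S"
    using T by (simp add: min_generates_def term_ideal_eq_iff)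
  have "S \<subseteq> T"
  proof
    fix s assume s: "s \<in> S"
    then have "s \<in> multiples T" using m multiples_superset by blast
    then obtain t u where t: "t \<in> T" "s = t + u" by (auto simp: multiples_def)
    have "t \<in> multiples S" using t m multiples_superset by blast
    then have "t \<noteq> 0" using S by (auto simp: multiples_def indets_def)
    moreover obtain i where "s = indet i" using s S by (auto simp: indets_def)
    ultimately have "t = s" using t indet_eq_addD by metis
    then show "s \<in> T" using t by simp
  qed
  moreover have "\<not> S \<subset> T" using T by (auto simp: min_generates_def)
  ultimately show ?thesis by blast
qed

lemma S_set_eqI:
  assumes "S \<subseteq> indets" "LT_ideal \<sigma> J = term_ideal TYPE('k::field) S"
  shows "S_set \<sigma> (J :: ('n, 'k) mpoly set) = S"
  unfolding S_set_def assms(2)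
  using assms(1) min_generates_indets[OF assms(1)] min_generates_unique[OF assms(1)]
  by (intro the_equality) auto

section \<open>Term orderings and leading terms\<close>

context
  fixes \<sigma> :: "'n trm_rel"
  assumes \<sigma>: "term_ordering \<sigma>"
begin

lemma term_ordering_refl: "(t, t) \<in> \<sigma>"
  using \<sigma> by (auto simp: term_ordering_def linear_order_on_def partial_order_on_def
      preorder_on_def refl_on_def)

lemma term_ordering_trans: "(s, t) \<in> \<sigma> \<Longrightarrow> (t, u) \<in> \<sigma> \<Longrightarrow> (s, u) \<in> \<sigma>"
  using \<sigma> by (auto simp: term_ordering_def linear_order_on_def partial_order_on_def
      preorder_on_def dest: transD)

lemma term_ordering_antisym: "(s, t) \<in> \<sigma> \<Longrightarrow> (t, s) \<in> \<sigma> \<Longrightarrow> s = t"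
  using \<sigma> by (auto simp: term_ordering_def linear_order_on_def partial_order_on_def
      dest: antisymD)

lemma term_ordering_total: "(s, t) \<in> \<sigma> \<or> (t, s) \<in> \<sigma>"
  using \<sigma> term_ordering_refl
  by (cases "s = t") (auto simp: term_ordering_def linear_order_on_def total_on_def)

lemma term_ordering_add: "(s, t) \<in> \<sigma> \<Longrightarrow> (s + u, t + u) \<in> \<sigma>"
  using \<sigma> by (auto simp: term_ordering_def)

lemma term_ordering_min:
  assumes "finite A" "A \<noteq> {}"
  shows "\<exists>x\<in>A. \<forall>y\<in>A. (x, y) \<in> \<sigma>"
  using assms
proof (induction A rule: finite_ne_induct)
  case (insert a A)
  then obtain x where "x \<in> A" "\<forall>y\<in>A. (x, y) \<in> \<sigma>" by blast
  then show ?case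
    using term_ordering_total[of a x] term_ordering_refl[of a] term_ordering_trans[of a x] by blast
qed (simp add: term_ordering_refl)

lemma term_ordering_max:
  assumes "finite A" "A \<noteq> {}"
  shows "\<exists>x\<in>A. \<forall>y\<in>A. (y, x) \<in> \<sigma>"
  using assms
proof (induction A rule: finite_ne_induct)
  case (insert a A)
  then obtain x where "x \<in> A" "\<forall>y\<in>A. (y, x) \<in> \<sigma>" by blast
  then show ?case
    using term_ordering_total[of a x] term_ordering_refl[of a] term_ordering_trans[of _ x a] by blast
qed (simp add: term_ordering_refl)

lemma LT_eqI: "t \<in> supp f \<Longrightarrow> (\<And>s. s \<in> supp f \<Longrightarrow> (s, t) \<in> \<sigma>) \<Longrightarrow> LT \<sigma> f = t"
  unfolding LT_def using term_ordering_antisym by (intro the_equality) auto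

lemma LT_props:
  assumes "f \<noteq> 0"
  shows LT_in_supp: "LT \<sigma> f \<in> supp f" and LT_greatest: "s \<in> supp f \<Longrightarrow> (s, LT \<sigma> f) \<in> \<sigma>"
proof -
  have "supp f \<noteq> {}" using assms by simp
  then obtain t where t: "t \<in> supp f" "\<forall>s\<in>supp f. (s, t) \<in> \<sigma>"
    using term_ordering_max[of "supp f"] by auto
  then have "LT \<sigma> f = t" by (intro LT_eqI) auto
  with t show "LT \<sigma> f \<in> supp f" "s \<in> supp f \<Longrightarrow> (s, LT \<sigma> f) \<in> \<sigma>" by auto
qed

end

text \<open>The classical uniqueness argument: if monic \<open>g\<close> and \<open>h\<close> share
  their leading term, then \<open>g - h\<close> lies in \<open>J\<close> and only tail terms remain,
  none of which is a leading term of \<open>J\<close>; hence it is 0. Two orderings are allowed so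
  that bases belonging to different orderings can be compared.\<close>

lemma reduced_groebner_basis_subset:
  fixes J :: "('n, 'k::field) mpoly set"
  assumes \<sigma>: "term_ordering \<sigma>" and J: "ideal J poly_ring"
    and G: "reduced_groebner_basis \<sigma> J G" and H: "reduced_groebner_basis \<tau> J H"
    and same: "LT_set \<sigma> J = LT_set \<tau> J" "LT \<sigma> ` G \<subseteq> LT \<tau> ` H"
  shows "marked \<sigma> G \<subseteq> marked \<tau> H"
proof -
  have "\<exists>h\<in>H. g = h \<and> LT \<sigma> g = LT \<tau> h" if g: "g \<in> G" for g
  proof -
    obtain h where h: "h \<in> H" "LT \<tau> h = LT \<sigma> g" using g same(2) by force
    have "g - h \<in> J"
      using g h G H by (auto simp: reduced_groebner_basis_def groebner_basis_def intro!: ideal_diff[OF J])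
    moreover have "supp (g - h) \<inter> LT_set \<sigma> J = {}"
    proof -
      define x :: "('n, 'k) mpoly" where "x = term_poly (LT \<sigma> g)"
      have "g - h = (g - x) + - (h - x)" by simp
      then have "supp (g - h) \<subseteq> supp (g - x) \<union> supp (h - x)"
        by (metis keys_add keys_minus)
      moreover have "supp (g - x) \<inter> LT_set \<sigma> J = {}"
        using g G by (simp add: reduced_groebner_basis_def x_def)
      moreover have "supp (h - x) \<inter> LT_set \<sigma> J = {}"
        unfolding x_def same(1) h(2)[symmetric] using h(1) H
        by (auto simp: reduced_groebner_basis_def simp del: Int_iff)
      ultimately show ?thesis by blast
    qed
    ultimately have "g - h = 0"
      using LT_in_supp[OF \<sigma>, of "g - h"] by (auto simp: LT_set_def)
    then show ?thesis using h by auto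
  qed
  then show ?thesis by (auto simp: marked_def)
qed

section \<open>Monomial substitutions\<close>

text \<open>The \<open>K\<close>-linear map that replaces a term \<open>t\<close> by
  \<open>w t\<close> times \<open>m t\<close>. It is a ring endomorphism fixing constants as soon as
  \<open>m\<close> and \<open>w\<close> are monoid homomorphisms.\<close>

definition subst :: "('n trm \<Rightarrow> 'n trm) \<Rightarrow> ('n trm \<Rightarrow> 'k) \<Rightarrow> ('n, 'k::field) mpoly \<Rightarrow> ('n, 'k) mpoly" where
  "subst m w p = (\<Sum>t\<in>supp p. Poly_Mapping.single (m t) (coeff p t * w t))"

lemma subst_superset:
  assumes "finite A" "supp p \<subseteq> A"
  shows "subst m w p = (\<Sum>t\<in>A. Poly_Mapping.single (m t) (coeff p t * w t))"
  unfolding subst_def using assms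
  by (intro sum.mono_neutral_left) (auto simp: in_keys_iff)

lemma subst_zero [simp]: "subst m w 0 = 0"
  by (simp add: subst_def)

lemma subst_add: "subst m w (p + q) = subst m w p + subst m w q"
proof -
  \<comment> \<open>Summing over a common superset of the three supports lets the sums be compared
    summand by summand.\<close>
  have "subst m w x = (\<Sum>t\<in>supp p \<union> supp q. Poly_Mapping.single (m t) (coeff x t * w t))"
    if "x \<in> {p, q, p + q}" for x
    using that keys_add[of p q] by (intro subst_superset) auto
  then show ?thesis
    by (simp add: lookup_add distrib_right single_add sum.distrib)
qed

lemma subst_single [simp]: "subst m w (Poly_Mapping.single t c) = Poly_Mapping.single (m t) (c * w t)"
  by (subst subst_superset[of "{t}"]) auto

lemma subst_mult:
  assumes m: "\<And>s t. m (s + t) = m s + m t" and w: "\<And>s t. w (s + t) = w s * w t"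
  shows "subst m w (p * q) = subst m w p * subst m w q"
proof (induction p rule: mpoly_induct)
  case (single s a)
  show ?case
    by (induction q rule: mpoly_induct)
      (simp_all add: mult_single m w subst_add distrib_left mult.left_commute mult.assoc)
qed (simp add: distrib_right subst_add)

section \<open>Ideals generated by linear forms with at most two terms\<close>

text \<open>Cotangent equivalence on indices when \<open>L\<close> is \<open>Lin I\<close>. One
  congruence alone would relate a trivial indeterminate to every other, by taking
  \<open>c = 0\<close>.\<close>

definition cotangent_rel :: "('n, 'k::field) mpoly set \<Rightarrow> 'n \<Rightarrow> 'n \<Rightarrow> bool" where
  "cotangent_rel L i j \<longleftrightarrow>
    (\<exists>c. indet_poly i - const_poly c * indet_poly j \<in> L) \<and>
    (\<exists>c. indet_poly j - const_poly c * indet_poly i \<in> L)"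

text \<open>The candidate for \<open>S\<^sub>\<sigma>\<close>: the trivial indeterminates and those
  that are not \<sigma>-least in their class.\<close>

definition leading_indets :: "'n trm_rel \<Rightarrow> ('n, 'k::field) mpoly set \<Rightarrow> 'n trm set" where
  "leading_indets \<sigma> L = {indet i | i.
    indet_poly i \<in> L \<or> (\<exists>j. j \<noteq> i \<and> cotangent_rel L i j \<and> (indet j, indet i) \<in> \<sigma>)}"

text \<open>In the application \<open>L\<close> is \<open>Lin I\<close> and \<open>F\<close>
  consists of the linear parts of the given generators.\<close>

locale two_term_span =
  fixes L F :: "('n::finite, 'k::field) mpoly set"
  assumes L_span: "L = K_span F"
    and two_term: "p \<in> F \<Longrightarrow> \<exists>a b i j. p = const_poly a * indet_poly i + const_poly b * indet_poly j"
begin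

lemma L_subspace: "poly_vs.subspace L"
  unfolding L_span K_span_def by simp

lemmas L_zero = poly_vs.subspace_0[OF L_subspace]
  and L_add = poly_vs.subspace_add[OF L_subspace]
  and L_diff = poly_vs.subspace_diff[OF L_subspace]
  and L_scale = poly_vs.subspace_scale[OF L_subspace]

lemma L_scale_iff: "c \<noteq> 0 \<Longrightarrow> const_poly c * p \<in> L \<longleftrightarrow> p \<in> L"
proof
  assume c: "c \<noteq> 0" and "const_poly c * p \<in> L"
  from L_scale[OF this(2), of "inverse c"] have "const_poly (inverse c * c) * p \<in> L"
    by (simp only: const_poly_mult mult.assoc)
  with c show "p \<in> L" by simp
qed (rule L_scale)

lemma cotangent_rel_refl: "cotangent_rel L i i"
  unfolding cotangent_rel_def using L_zero by (auto intro!: exI[of _ 1])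

lemma cotangent_rel_sym: "cotangent_rel L i j \<Longrightarrow> cotangent_rel L j i"
  by (auto simp: cotangent_rel_def)

lemma indet_rel_trans:
  assumes "indet_poly i - const_poly c * indet_poly j \<in> L" "indet_poly j - const_poly d * indet_poly k \<in> L"
  shows "indet_poly i - const_poly (c * d) * indet_poly k \<in> L"
proof -
  have "indet_poly i - const_poly c * indet_poly j
      + (const_poly c * indet_poly j - const_poly (c * d) * indet_poly k) \<in> L"
    using L_add[OF assms(1) L_scale[OF assms(2), of c]]
    by (simp only: const_poly_mult right_diff_distrib mult.assoc)
  then show ?thesis by simp
qed

lemma cotangent_rel_trans: "cotangent_rel L i j \<Longrightarrow> cotangent_rel L j k \<Longrightarrow> cotangent_rel L i k"
  unfolding cotangent_rel_def using indet_rel_trans by blast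

lemma indet_in_L_iff_of_rel:
  assumes "cotangent_rel L i j"
  shows "indet_poly i \<in> L \<longleftrightarrow> indet_poly j \<in> L"
proof -
  have "indet_poly j \<in> L" if "indet_poly i \<in> L" "indet_poly j - const_poly c * indet_poly i \<in> L" for i j c
    using L_add[OF that(2) L_scale[OF that(1), of c]] by simp
  with assms show ?thesis unfolding cotangent_rel_def by blast
qed

text \<open>If one coefficient is 0, a multiple of a single indeterminate outside \<open>L\<close>
  lies in \<open>L\<close>, so the other coefficient is 0 as well. Otherwise dividing by
  \<open>a\<close> and by \<open>b\<close> gives the two required congruences.\<close>

lemma two_term_in_L:
  assumes "const_poly a * indet_poly i + const_poly b * indet_poly j \<in> L"
    and "indet_poly i \<notin> L" "indet_poly j \<notin> L"
  shows "a = 0 \<and> b = 0 \<or> cotangent_rel L i j"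
proof (cases "a = 0 \<or> b = 0")
  case True
  with assms show ?thesis
    using L_scale_iff[of a "indet_poly i"] L_scale_iff[of b "indet_poly j"]
    by (cases "a = 0"; cases "b = 0") auto
next
  case False
  have *: "indet_poly i - const_poly (- b / a) * indet_poly j \<in> L"
    if "const_poly a * indet_poly i + const_poly b * indet_poly j \<in> L" "a \<noteq> 0" for a b i j
  proof -
    have "const_poly (inverse a * a) * indet_poly i + const_poly (inverse a * b) * indet_poly j \<in> L"
      using L_scale[OF that(1), of "inverse a"] by (simp only: const_poly_mult distrib_left mult.assoc)
    moreover define c where "c = - b / a"
    moreover have "const_poly (inverse a * b) = - (const_poly c :: ('n, 'k) mpoly)"
      by (simp add: c_def const_poly_def divide_inverse mult.commute flip: single_uminus)
    ultimately show ?thesis using that(2) by simp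
  qed
  have "indet_poly i - const_poly (- b / a) * indet_poly j \<in> L"
    using *[OF assms(1)] False by simp
  moreover have "indet_poly j - const_poly (- a / b) * indet_poly i \<in> L"
    using *[of b j a i] assms(1) False by (simp add: add.commute)
  ultimately show ?thesis unfolding cotangent_rel_def by blast
qed

end

section \<open>The normal form endomorphism for a fixed term ordering\<close>

locale two_term_order = two_term_span L F
  for L F :: "('n::finite, 'k::field) mpoly set" +
  fixes \<sigma> :: "'n trm_rel"
  assumes \<sigma>: "term_ordering \<sigma>"
begin

definition rep :: "'n \<Rightarrow> 'n" where
  "rep i = (SOME j. cotangent_rel L i j \<and> (\<forall>k. cotangent_rel L i k \<longrightarrow> (indet j, indet k) \<in> \<sigma>))"

text \<open>The intended substitution is \<open>x\<^sub>i\<close> to \<open>fac i\<close> times the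
  indeterminate of \<open>rep i\<close>; the value 0 makes it kill the trivial
  indeterminates.\<close>

definition fac :: "'n \<Rightarrow> 'k" where
  "fac i = (if indet_poly i \<in> L then 0 else SOME c. indet_poly i - const_poly c * indet_poly (rep i) \<in> L)"

lemma rep: "cotangent_rel L i (rep i)" "cotangent_rel L i k \<Longrightarrow> (indet (rep i), indet k) \<in> \<sigma>"
proof -
  have "\<exists>x\<in>indet ` {j. cotangent_rel L i j}. \<forall>y\<in>indet ` {j. cotangent_rel L i j}. (x, y) \<in> \<sigma>"
    by (rule term_ordering_min[OF \<sigma>]) (use cotangent_rel_refl in auto)
  then have "\<exists>j. cotangent_rel L i j \<and> (\<forall>k. cotangent_rel L i k \<longrightarrow> (indet j, indet k) \<in> \<sigma>)"
    by auto
  from someI_ex[OF this] show "cotangent_rel L i (rep i)"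
    "cotangent_rel L i k \<Longrightarrow> (indet (rep i), indet k) \<in> \<sigma>"
    unfolding rep_def by blast+
qed

lemma rep_le: "(indet (rep i), indet i) \<in> \<sigma>"
  by (rule rep(2)) (rule cotangent_rel_refl)

lemma rep_eqI:
  assumes "cotangent_rel L i j"
  shows "rep i = rep j"
proof -
  have "(indet (rep i), indet (rep j)) \<in> \<sigma>" if "cotangent_rel L i j" for i j
    using that rep cotangent_rel_trans by blast
  then have "indet (rep i) = indet (rep j)"
    using term_ordering_antisym[OF \<sigma>] assms cotangent_rel_sym by blast
  then show ?thesis by simp
qed

lemma rep_rep [simp]: "rep (rep i) = rep i"
  using rep_eqI[OF rep(1)] by simp

lemma fac: "indet_poly i - const_poly (fac i) * indet_poly (rep i) \<in> L"
proof (cases "indet_poly i \<in> L")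
  case False
  then show ?thesis
    using rep(1)[of i] unfolding cotangent_rel_def fac_def by (auto intro: someI_ex)
qed (simp add: fac_def)

lemma leading_indets_iff: "indet i \<in> leading_indets \<sigma> L \<longleftrightarrow> indet_poly i \<in> L \<or> rep i \<noteq> i"
proof -
  have "(\<exists>j. j \<noteq> i \<and> cotangent_rel L i j \<and> (indet j, indet i) \<in> \<sigma>) \<longleftrightarrow> rep i \<noteq> i"
    using rep[of i] rep_le[of i] term_ordering_antisym[OF \<sigma>] indet_eq_iff by metis
  then show ?thesis by (auto simp: leading_indets_def)
qed

text \<open>Here \<open>rep i = i\<close>, so \<open>1 - fac i\<close> times an indeterminate
  outside \<open>L\<close> lies in \<open>L\<close>.\<close>

lemma fac_not_leading:
  assumes "indet i \<notin> leading_indets \<sigma> L"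
  shows "fac i = 1"
proof (rule ccontr)
  assume "fac i \<noteq> 1"
  moreover have "const_poly (1 - fac i) * indet_poly i \<in> L"
    using fac[of i] assms
    by (simp add: leading_indets_iff const_poly_def single_diff algebra_simps)
  ultimately show False using assms by (auto simp: L_scale_iff leading_indets_iff)
qed

lemma rep_not_leading: "fac i \<noteq> 0 \<Longrightarrow> indet (rep i) \<notin> leading_indets \<sigma> L"
  using indet_in_L_iff_of_rel[OF rep(1)] by (auto simp: leading_indets_iff fac_def split: if_splits)

text \<open>Together with \<open>nf_fac\<close> this extends the substitution multiplicatively to
  terms. Since \<open>0 ^ 0 = 1\<close>, the factor vanishes only on terms that actually contain an
  indeterminate with \<open>fac i = 0\<close>.\<close>

definition nf_trm :: "'n trm \<Rightarrow> 'n trm" where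
  "nf_trm t = (\<Sum>i\<in>UNIV. Poly_Mapping.single (rep i) (Poly_Mapping.lookup t i))"

definition nf_fac :: "'n trm \<Rightarrow> 'k" where
  "nf_fac t = (\<Prod>i\<in>UNIV. fac i ^ Poly_Mapping.lookup t i)"

abbreviation nf :: "('n, 'k) mpoly \<Rightarrow> ('n, 'k) mpoly" where
  "nf \<equiv> subst nf_trm nf_fac"

lemma nf_trm_add: "nf_trm (s + t) = nf_trm s + nf_trm t"
  by (simp add: nf_trm_def lookup_add single_add sum.distrib)

lemma nf_fac_add: "nf_fac (s + t) = nf_fac s * nf_fac t"
  by (simp add: nf_fac_def lookup_add power_add prod.distrib)

lemma nf_mult: "nf (p * q) = nf p * nf q"
  by (rule subst_mult) (rule nf_trm_add nf_fac_add)+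

lemma nf_trm_zero [simp]: "nf_trm 0 = 0"
  by (simp add: nf_trm_def)

lemma nf_fac_zero [simp]: "nf_fac 0 = 1"
  by (simp add: nf_fac_def)

lemma nf_trm_indet [simp]: "nf_trm (indet i) = indet (rep i)"
proof -
  have "nf_trm (indet i) = (\<Sum>j\<in>UNIV. if j = i then indet (rep i) else 0)"
    unfolding nf_trm_def by (rule sum.cong) (auto simp: indet_def lookup_single when_def)
  then show ?thesis by simp
qed

lemma nf_fac_indet [simp]: "nf_fac (indet i) = fac i"
proof -
  have "nf_fac (indet i) = (\<Prod>j\<in>UNIV. if j = i then fac i else 1)"
    unfolding nf_fac_def by (rule prod.cong) (auto simp: indet_def lookup_single when_def)
  then show ?thesis by simp
qed

lemma nf_const [simp]: "nf (const_poly c) = const_poly c"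
  by (simp add: const_poly_def)

lemma nf_indet_poly: "nf (indet_poly i) = const_poly (fac i) * indet_poly (rep i)"
  by (simp add: indet_poly_def term_poly_def const_poly_def mult_single)

text \<open>Indeterminates are replaced one at a time by smaller or equal ones, and \<sigma> is
  compatible with multiplication.\<close>

lemma nf_trm_le: "(nf_trm t, t) \<in> \<sigma>"
proof (induction "trm_deg t" arbitrary: t)
  case 0
  then show ?case by (simp add: term_ordering_refl[OF \<sigma>])
next
  case (Suc d)
  then have "t \<noteq> 0" by auto
  then obtain i u where t: "t = indet i + u" using nonzero_indet_adds by blast
  with Suc have "(nf_trm u, u) \<in> \<sigma>" by simp
  from term_ordering_add[OF \<sigma> this, of "indet (rep i)"] term_ordering_add[OF \<sigma> rep_le, of i u]
  show ?case
    using term_ordering_trans[OF \<sigma>] by (auto simp: t nf_trm_add add.commute)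
qed

lemma not_multiple_imp_nf:
  assumes "t \<notin> multiples (leading_indets \<sigma> L)"
  shows "nf_trm t = t \<and> nf_fac t = 1"
  using assms
proof (induction "trm_deg t" arbitrary: t)
  case (Suc d)
  then have "t \<noteq> 0" by auto
  then obtain i u where t: "t = indet i + u" using nonzero_indet_adds by blast
  with Suc have "nf_trm u = u \<and> nf_fac u = 1"
    using multiples_add[of u _ "indet i"] by (auto simp: add.commute)
  moreover have "indet i \<notin> leading_indets \<sigma> L"
    using t Suc.prems multiplesI by blast
  ultimately show ?case
    using fac_not_leading[of i] by (auto simp: t nf_trm_add nf_fac_add leading_indets_iff)
qed simp

text \<open>The kernel of \<open>nf\<close> is a subspace, so only the spanning forms in
  \<open>F\<close> need to be checked. If one of the two indeterminates is trivial, the remaining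
  summand lies in \<open>L\<close> by itself.\<close>

lemma nf_L:
  assumes "p \<in> L"
  shows "nf p = 0"
proof -
  have "poly_vs.subspace {p. nf p = 0}"
    by (simp add: poly_vs.subspace_def subst_add nf_mult)
  moreover have "F \<subseteq> {p. nf p = 0}"
  proof
    fix p assume p: "p \<in> F"
    then obtain a b i j where eq: "p = const_poly a * indet_poly i + const_poly b * indet_poly j"
      using two_term by blast
    have pL: "p \<in> L" using p unfolding L_span K_span_def by (rule poly_vs.span_base)
    have zero: "nf (const_poly a * indet_poly i) = 0" if "indet_poly i \<in> L" for a i
      using that by (simp add: nf_mult nf_indet_poly fac_def)
    have zero': "nf (const_poly a * indet_poly i) = 0" if "const_poly a * indet_poly i \<in> L" for a i
      using that zero[of i a] L_scale_iff[of a "indet_poly i"] by (cases "a = 0") auto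
    have drop: "a = 0" if "const_poly a * indet_poly i \<in> L" "indet_poly i \<notin> L" for a i
      using that L_scale_iff by blast
    consider "indet_poly i \<in> L" | "indet_poly j \<in> L"
      | "indet_poly i \<notin> L" "indet_poly j \<notin> L" "a = 0 \<and> b = 0"
      | "indet_poly i \<notin> L" "indet_poly j \<notin> L" "cotangent_rel L i j"
      using two_term_in_L pL eq by blast
    then have "nf p = 0"
    proof cases
      case 1
      with pL eq have "const_poly b * indet_poly j \<in> L"
        using L_diff[OF pL L_scale[OF 1, of a]] by simp
      then show ?thesis using zero' zero[OF 1] by (simp add: eq subst_add)
    next
      case 2
      with pL eq have "const_poly a * indet_poly i \<in> L"
        using L_diff[OF pL L_scale[OF 2, of b]] by simp
      then show ?thesis using zero' zero[OF 2] by (simp add: eq subst_add)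
    next
      case 3
      then show ?thesis by (simp add: eq)
    next
      case 4
      have r: "rep j = rep i" using rep_eqI[OF 4(3)] by simp
      \<comment> \<open>Both indeterminates have the same representative, so \<open>nf p\<close> is
        \<open>s\<close> times one indeterminate outside \<open>L\<close>. As \<open>p\<close> and
        \<open>p - nf p\<close> lie in \<open>L\<close>, so does \<open>nf p\<close>, which forces
        \<open>s = 0\<close>.\<close>
      define s where "s = a * fac i + b * fac j"
      have nfp: "nf p = const_poly s * indet_poly (rep i)"
        by (simp only: eq subst_add nf_mult nf_const nf_indet_poly r s_def const_poly_add
            const_poly_mult distrib_right mult.assoc)
      have "p - nf p = const_poly a * (indet_poly i - const_poly (fac i) * indet_poly (rep i))
          + const_poly b * (indet_poly j - const_poly (fac j) * indet_poly (rep j))"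
        by (simp only: eq subst_add nf_mult nf_const nf_indet_poly right_diff_distrib add_diff_add)
      then have "p - nf p \<in> L" using fac by (simp add: L_add L_scale)
      then have "nf p \<in> L" using L_diff[OF pL, of "p - nf p"] by simp
      moreover have "indet_poly (rep i) \<notin> L" using indet_in_L_iff_of_rel[OF rep(1)] 4(1) by blast
      ultimately have "s = 0" unfolding nfp using drop by blast
      then show ?thesis by (simp add: nfp)
    qed
    then show "p \<in> {p. nf p = 0}" by simp
  qed
  ultimately have "K_span F \<subseteq> {p. nf p = 0}"
    unfolding K_span_def by (rule poly_vs.span_minimal[rotated])
  then show ?thesis using assms L_span by blast
qed

lemma nf_ideal_gen:
  assumes "p \<in> ideal_gen L"
  shows "nf p = 0"
proof -
  have "ideal {p. nf p = 0} poly_ring"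
    by (auto simp: ideal_poly_ring_iff subst_add nf_mult)
  then have "ideal_gen L \<subseteq> {p. nf p = 0}"
    by (rule ideal_gen_minimal) (use nf_L in auto)
  then show ?thesis using assms by auto
qed

text \<open>Otherwise \<open>nf\<close> would fix the leading term of \<open>g\<close>, and its
  coefficient would survive in \<open>nf g\<close>, which is 0.\<close>

lemma LT_multiple:
  assumes g: "g \<in> ideal_gen L" "g \<noteq> 0"
  shows "LT \<sigma> g \<in> multiples (leading_indets \<sigma> L)"
proof (rule ccontr)
  define t where "t = LT \<sigma> g"
  assume "LT \<sigma> g \<notin> multiples (leading_indets \<sigma> L)"
  then have nft: "nf_trm t = t" "nf_fac t = 1"
    using not_multiple_imp_nf unfolding t_def by blast+
  have t: "t \<in> supp g" using LT_in_supp[OF \<sigma>] g unfolding t_def by blast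
  \<comment> \<open>No other term of \<open>g\<close> is mapped to \<open>t\<close>: from
    \<open>nf_trm s = t\<close> follows that \<open>t\<close> is at most \<open>s\<close>, and
    \<open>s\<close> is at most the leading term \<open>t\<close>.\<close>
  have "nf_trm s = t \<longleftrightarrow> s = t" if "s \<in> supp g" for s
    using LT_greatest[OF \<sigma> g(2) that] nf_trm_le[of s] nft term_ordering_antisym[OF \<sigma>, of s t]
    unfolding t_def by auto
  then have "coeff (nf g) t = (\<Sum>s\<in>supp g. if s = t then coeff g t else 0)"
    unfolding subst_def lookup_sum
    by (intro sum.cong) (auto simp: lookup_single when_def nft)
  also have "\<dots> = coeff g t" using t by simp
  finally have "coeff g t = 0" using nf_ideal_gen[OF g(1)] by simp
  with t show False by (simp add: in_keys_iff)
qed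

section \<open>Leading terms and the reduced Groebner basis\<close>

definition rewriter :: "'n \<Rightarrow> ('n, 'k) mpoly" where
  "rewriter i = indet_poly i - const_poly (fac i) * indet_poly (rep i)"

lemma rewriter_in_ideal: "rewriter i \<in> ideal_gen L"
  unfolding rewriter_def using fac ideal_gen_superset by blast

text \<open>The cofactor \<open>u\<close> is included in order to realise every multiple of a
  leading indeterminate as a leading term.\<close>

lemma shifted_rewriter:
  fixes u :: "'n trm"
  assumes i: "indet i \<in> leading_indets \<sigma> L"
  defines "p \<equiv> Poly_Mapping.single u 1 * rewriter i"
  shows LT_shifted_rewriter: "LT \<sigma> p = indet i + u"
    and coeff_shifted_rewriter: "coeff p (indet i + u) = 1"
proof -
  have p: "p = Poly_Mapping.single (indet i + u) 1 - Poly_Mapping.single (indet (rep i) + u) (fac i)"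
    by (simp add: p_def rewriter_def right_diff_distrib indet_poly_def term_poly_def const_poly_def
        mult_single add.commute)
  \<comment> \<open>Either the second monomial vanishes or its term differs from the first, so the
    coefficient 1 cannot cancel.\<close>
  have ne: "fac i = 0 \<or> rep i \<noteq> i" using i by (auto simp: leading_indets_iff fac_def)
  then show c: "coeff p (indet i + u) = 1"
    by (auto simp: p lookup_minus lookup_single when_def)
  show "LT \<sigma> p = indet i + u"
  proof (rule LT_eqI[OF \<sigma>])
    show "indet i + u \<in> supp p" using c by (simp add: in_keys_iff)
    fix s assume "s \<in> supp p"
    then have "s = indet i + u \<or> s = indet (rep i) + u"
      by (auto simp: p in_keys_iff lookup_minus lookup_single when_def split: if_splits)
    then show "(s, indet i + u) \<in> \<sigma>"
      using term_ordering_add[OF \<sigma> rep_le] term_ordering_refl[OF \<sigma>] by auto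
  qed
qed

lemma rewriter_props:
  assumes i: "indet i \<in> leading_indets \<sigma> L"
  shows LT_rewriter: "LT \<sigma> (rewriter i) = indet i"
    and coeff_rewriter: "coeff (rewriter i) (indet i) = 1"
  using shifted_rewriter[OF i, of 0] by (simp_all only: single_one mult_1 add_0_right)

lemma leading_indets_subset: "leading_indets \<sigma> L \<subseteq> indets"
  by (auto simp: leading_indets_def indets_def)

lemma LT_set_eq: "LT_set \<sigma> (ideal_gen L) = multiples (leading_indets \<sigma> L)"
proof
  show "LT_set \<sigma> (ideal_gen L) \<subseteq> multiples (leading_indets \<sigma> L)"
    using LT_multiple by (auto simp: LT_set_def)
  show "multiples (leading_indets \<sigma> L) \<subseteq> LT_set \<sigma> (ideal_gen L)"
  proof
    fix t assume "t \<in> multiples (leading_indets \<sigma> L)"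
    then obtain i u where t: "t = indet i + u" and i: "indet i \<in> leading_indets \<sigma> L"
      using leading_indets_subset by (auto simp: multiples_def indets_def)
    let ?p = "Poly_Mapping.single u 1 * rewriter i"
    have "?p \<in> ideal_gen L" by (rule ideal_mult[OF ideal_ideal_gen rewriter_in_ideal])
    moreover have "?p \<noteq> 0" using coeff_shifted_rewriter[OF i, of u] by force
    ultimately show "t \<in> LT_set \<sigma> (ideal_gen L)"
      unfolding LT_set_def t using LT_shifted_rewriter[OF i, of u] by force
  qed
qed

lemma LT_ideal_eq: "LT_ideal \<sigma> (ideal_gen L) = term_ideal TYPE('k) (leading_indets \<sigma> L)"
proof -
  have "multiples (multiples T) = multiples T" for T :: "'n trm set"
    by (intro equalityI multiples_least multiples_superset order_refl)
  then show ?thesis unfolding LT_ideal_def LT_set_eq term_ideal_eq_iff .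
qed

lemma S_set_eq: "S_set \<sigma> (ideal_gen L) = leading_indets \<sigma> L"
  using leading_indets_subset LT_ideal_eq by (rule S_set_eqI)

lemma reduced_groebner_basis_LT:
  assumes "reduced_groebner_basis \<sigma> (ideal_gen L) G"
  shows "LT \<sigma> ` G = leading_indets \<sigma> L"
proof -
  have "min_generates (LT \<sigma> ` G) (term_ideal TYPE('k) (leading_indets \<sigma> L))"
    using assms by (simp add: reduced_groebner_basis_def LT_ideal_eq)
  then show ?thesis by (rule min_generates_unique[OF leading_indets_subset])
qed

text \<open>The rewriters of the leading indeterminates are monic, and each tail is zero or a
  multiple of a representative that is neither trivial nor replaceable. By irreducibility such a
  representative is no multiple of a leading indeterminate.\<close>

lemma reduced_groebner_basis_exists: "\<exists>G. reduced_groebner_basis \<sigma> (ideal_gen L) G"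
proof
  define A where "A = {i. indet i \<in> leading_indets \<sigma> L}"
  have A: "indet ` A = leading_indets \<sigma> L"
    using leading_indets_subset unfolding A_def indets_def by blast
  have "LT \<sigma> ` rewriter ` A = indet ` A"
    unfolding image_image by (rule image_cong) (auto simp: A_def LT_rewriter)
  with A have LT: "LT \<sigma> ` rewriter ` A = leading_indets \<sigma> L" by simp
  have "rewriter i \<noteq> 0" if "i \<in> A" for i
    using coeff_rewriter[of i] that unfolding A_def by (metis lookup_zero mem_Collect_eq zero_neq_one)
  then have "rewriter ` A \<subseteq> ideal_gen L - {0}" using rewriter_in_ideal by auto
  then have gb: "groebner_basis \<sigma> (ideal_gen L) (rewriter ` A)"
    by (simp add: groebner_basis_def LT LT_ideal_eq)
  have tail: "supp (rewriter i - term_poly (indet i)) \<inter> LT_set \<sigma> (ideal_gen L) = {}" if i: "i \<in> A" for i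
  proof (cases "fac i = 0")
    case True
    then show ?thesis by (simp add: rewriter_def indet_poly_def)
  next
    case False
    have "indet (rep i) \<notin> multiples (leading_indets \<sigma> L)"
    proof
      assume "indet (rep i) \<in> multiples (leading_indets \<sigma> L)"
      then obtain s u where su: "indet (rep i) = s + u" "s \<in> leading_indets \<sigma> L"
        by (auto simp: multiples_def)
      moreover from this obtain j where "s = indet j"
        using leading_indets_subset unfolding indets_def by blast
      ultimately have "s = indet (rep i)" using indet_eq_addD[of "rep i" s u] by simp
      then show False using rep_not_leading[OF False] su by simp
    qed
    moreover have "rewriter i - term_poly (indet i) = Poly_Mapping.single (indet (rep i)) (- fac i)"
      by (simp add: rewriter_def indet_poly_def term_poly_def const_poly_def mult_single single_uminus)
    ultimately show ?thesis using False by (simp add: LT_set_eq)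
  qed
  show "reduced_groebner_basis \<sigma> (ideal_gen L) (rewriter ` A)"
    unfolding reduced_groebner_basis_def LT LT_ideal_eq
  proof (intro conjI gb min_generates_indets leading_indets_subset; intro ballI)
    fix g assume "g \<in> rewriter ` A"
    then obtain i where i: "i \<in> A" "g = rewriter i" by blast
    then have "LT \<sigma> g = indet i" by (simp add: A_def LT_rewriter)
    with i tail show "coeff g (LT \<sigma> g) = 1" "supp (g - term_poly (LT \<sigma> g)) \<inter> LT_set \<sigma> (ideal_gen L) = {}"
      by (simp_all add: A_def coeff_rewriter)
  qed
qed

end

section \<open>The Groebner fan and its leading term sets\<close>

lemma (in two_term_span) GFan_props:
  shows LTGFan_eq: "LTGFan (ideal_gen L) = {leading_indets \<sigma> L | \<sigma>. term_ordering \<sigma>}"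
    and card_LTGFan_eq: "card (LTGFan (ideal_gen L)) = card (GFan (ideal_gen L))"
proof -
  have ord: "two_term_order L F \<sigma>" if "term_ordering \<sigma>" for \<sigma>
    using that by unfold_locales
  have fst: "fst ` marked \<sigma> G = LT \<sigma> ` G" for \<sigma> and G :: "('n, 'k) mpoly set"
    by (simp add: marked_def image_image)
  show "LTGFan (ideal_gen L) = {leading_indets \<sigma> L | \<sigma>. term_ordering \<sigma>}" (is "_ = ?rhs")
  proof
    show "LTGFan (ideal_gen L) \<subseteq> ?rhs"
    proof
      fix T assume "T \<in> LTGFan (ideal_gen L)"
      then obtain \<sigma> G where "T = LT \<sigma> ` G" and *: "term_ordering \<sigma>" "reduced_groebner_basis \<sigma> (ideal_gen L) G"
        by (auto simp: LTGFan_def GFan_def fst)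
      then have "T = leading_indets \<sigma> L"
        using two_term_order.reduced_groebner_basis_LT[OF ord[OF *(1)] *(2)] by simp
      with * show "T \<in> ?rhs" by blast
    qed
    show "?rhs \<subseteq> LTGFan (ideal_gen L)"
    proof safe
      fix \<sigma> :: "'n trm_rel" assume \<sigma>: "term_ordering \<sigma>"
      then obtain G where G: "reduced_groebner_basis \<sigma> (ideal_gen L) G"
        using two_term_order.reduced_groebner_basis_exists[OF ord] by blast
      then have "marked \<sigma> G \<in> GFan (ideal_gen L)" using \<sigma> by (auto simp: GFan_def)
      moreover have "fst ` marked \<sigma> G = leading_indets \<sigma> L"
        using two_term_order.reduced_groebner_basis_LT[OF ord[OF \<sigma>] G] by (simp add: fst)
      ultimately show "leading_indets \<sigma> L \<in> LTGFan (ideal_gen L)"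
        unfolding LTGFan_def by (metis imageI)
    qed
  qed
  \<comment> \<open>The leading terms of a reduced basis are the leading indeterminates, which
    determine all leading terms of the ideal; uniqueness of reduced bases then recovers the
    polynomials.\<close>
  have "inj_on (\<lambda>M. fst ` M) (GFan (ideal_gen L))"
  proof (rule inj_onI)
    fix M N assume "M \<in> GFan (ideal_gen L)" "N \<in> GFan (ideal_gen L)" and eq: "fst ` M = fst ` N"
    then obtain \<sigma> \<tau> G H where M: "M = marked \<sigma> G" "term_ordering \<sigma>" "reduced_groebner_basis \<sigma> (ideal_gen L) G"
      and N: "N = marked \<tau> H" "term_ordering \<tau>" "reduced_groebner_basis \<tau> (ideal_gen L) H"
      by (auto simp: GFan_def)
    note M' = ord[OF M(2)] and N' = ord[OF N(2)]
    have LT: "LT \<sigma> ` G = LT \<tau> ` H" using eq by (simp add: M N fst)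
    then have "leading_indets \<sigma> L = leading_indets \<tau> L"
      using two_term_order.reduced_groebner_basis_LT[OF M' M(3)]
        two_term_order.reduced_groebner_basis_LT[OF N' N(3)] by simp
    then have "LT_set \<sigma> (ideal_gen L) = LT_set \<tau> (ideal_gen L)"
      by (simp add: two_term_order.LT_set_eq[OF M'] two_term_order.LT_set_eq[OF N'])
    then show "M = N"
      unfolding M(1) N(1) using LT M N
      by (intro equalityI reduced_groebner_basis_subset[OF _ ideal_ideal_gen]) auto
  qed
  then show "card (LTGFan (ideal_gen L)) = card (GFan (ideal_gen L))"
    unfolding LTGFan_def by (rule card_image)
qed

section \<open>Lexicographic term orderings\<close>

text \<open>Exponents are compared first at the indeterminate with the largest value of
  \<open>h\<close>; \<open>k\<close> is the first place of difference.\<close>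

definition lex_ordering :: "('n \<Rightarrow> nat) \<Rightarrow> 'n trm_rel" where
  "lex_ordering h = {(s, t). s = t \<or>
    (\<exists>k. Poly_Mapping.lookup s k < Poly_Mapping.lookup t k \<and>
      (\<forall>j. h k < h j \<longrightarrow> Poly_Mapping.lookup s j = Poly_Mapping.lookup t j))}"

lemma term_ordering_lex:
  fixes h :: "'n::finite \<Rightarrow> nat"
  assumes h: "inj h"
  shows "term_ordering (lex_ordering h)"
proof -
  let ?l = Poly_Mapping.lookup
  have total: "(s, t) \<in> lex_ordering h \<or> (t, s) \<in> lex_ordering h" for s t
  proof (cases "s = t")
    case False
    then have "{i. ?l s i \<noteq> ?l t i} \<noteq> {}" using poly_mapping_eqI[of s t] by auto
    \<comment> \<open>The deciding position is the one of largest \<open>h\<close>-value among those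
      where the exponents differ.\<close>
    then have "Max (h ` {i. ?l s i \<noteq> ?l t i}) \<in> h ` {i. ?l s i \<noteq> ?l t i}"
      by (intro Max_in) auto
    then obtain k where k: "?l s k \<noteq> ?l t k" "h k = Max (h ` {i. ?l s i \<noteq> ?l t i})" by auto
    have above: "?l s j = ?l t j" if "h k < h j" for j
    proof (rule ccontr)
      assume "?l s j \<noteq> ?l t j"
      then have "h j \<le> h k" unfolding k(2) by (intro Max_ge) auto
      with that show False by simp
    qed
    from k(1) consider "?l s k < ?l t k" | "?l t k < ?l s k" by linarith
    then show ?thesis
    proof cases
      case 1
      with above have "(s, t) \<in> lex_ordering h" unfolding lex_ordering_def by auto
      then show ?thesis ..
    next
      case 2
      with above have "(t, s) \<in> lex_ordering h" unfolding lex_ordering_def by force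
      then show ?thesis ..
    qed
  qed (simp add: lex_ordering_def)
  have trans: "trans (lex_ordering h)"
  proof (rule transI)
    fix s t u assume st: "(s, t) \<in> lex_ordering h" and tu: "(t, u) \<in> lex_ordering h"
    show "(s, u) \<in> lex_ordering h"
    proof (cases "s = t \<or> t = u")
      case False
      then obtain k k' where k: "?l s k < ?l t k" "\<forall>j. h k < h j \<longrightarrow> ?l s j = ?l t j"
        and k': "?l t k' < ?l u k'" "\<forall>j. h k' < h j \<longrightarrow> ?l t j = ?l u j"
        using st tu unfolding lex_ordering_def by auto
      \<comment> \<open>The position with the larger \<open>h\<close>-value decides between
        \<open>s\<close> and \<open>u\<close>; injectivity of \<open>h\<close> makes a tie mean
        equal positions.\<close>
      consider "h k < h k'" | "h k' < h k" | "k = k'"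
        using h by (metis injD linorder_neqE_nat)
      then have "\<exists>m. ?l s m < ?l u m \<and> (\<forall>j. h m < h j \<longrightarrow> ?l s j = ?l u j)"
      proof cases
        case 1
        with k k' show ?thesis by (intro exI[of _ k']) (metis less_trans)
      next
        case 2
        with k k' show ?thesis by (intro exI[of _ k]) (metis less_trans)
      next
        case 3
        with k k' show ?thesis by (intro exI[of _ k]) (metis less_trans)
      qed
      then show ?thesis unfolding lex_ordering_def by blast
    qed (use st tu in auto)
  qed
  have antisym: "antisym (lex_ordering h)"
  proof (rule antisymI, rule ccontr)
    fix s t assume "(s, t) \<in> lex_ordering h" "(t, s) \<in> lex_ordering h" "s \<noteq> t"
    then obtain k k' where k: "?l s k < ?l t k" "\<forall>j. h k < h j \<longrightarrow> ?l s j = ?l t j"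
      and k': "?l t k' < ?l s k'" "\<forall>j. h k' < h j \<longrightarrow> ?l t j = ?l s j"
      unfolding lex_ordering_def by auto
    consider "h k < h k'" | "h k' < h k" | "k = k'"
      using h by (metis injD linorder_neqE_nat)
    then show False
      using k k' by cases (metis less_irrefl, metis less_irrefl, metis less_asym)
  qed
  have zero: "(0, t) \<in> lex_ordering h" for t
    using total[of 0 t] by (auto simp: lex_ordering_def)
  have add: "(s + u, t + u) \<in> lex_ordering h" if "(s, t) \<in> lex_ordering h" for s t u
    using that by (auto simp: lex_ordering_def lookup_add)
  have refl: "refl (lex_ordering h)" by (auto simp: refl_on_def lex_ordering_def)
  show ?thesis
    unfolding term_ordering_def linear_order_on_def partial_order_on_def preorder_on_def total_on_def
    by (intro conjI allI impI ballI trans antisym zero add refl total subset_UNIV) simp_all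
qed

lemma indet_lex_ordering_le:
  assumes "h i \<le> h j" "inj h"
  shows "(indet i, indet j) \<in> lex_ordering h"
proof (cases "i = j")
  case False
  with assms have "h i < h j" by (metis injD le_neq_implies_less)
  then show ?thesis
    unfolding lex_ordering_def
    by (auto simp: indet_def lookup_single when_def intro!: exI[of _ j])
qed (simp add: lex_ordering_def)

text \<open>Lexicographic orderings can put any prescribed set of indeterminates below all others,
  which is what realises arbitrary choices of least elements.\<close>

lemma term_ordering_below:
  fixes D :: "'n::finite trm set"
  shows "\<exists>\<sigma>. term_ordering \<sigma> \<and> (\<forall>x\<in>D \<inter> indets. \<forall>y\<in>indets - D. (x, y) \<in> \<sigma>)"
proof -
  obtain g :: "'n \<Rightarrow> nat" where g: "inj g"
    using finite_imp_inj_to_nat_seg[of "UNIV :: 'n set"] by auto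
  \<comment> \<open>\<open>N\<close> exceeds all values of \<open>g\<close>, so the shift by
    \<open>N\<close> keeps \<open>h\<close> injective and moves the indeterminates outside
    \<open>D\<close> above those in \<open>D\<close>.\<close>
  define N where "N = Suc (Max (range g))"
  have N: "g i < N" for i by (simp add: N_def less_Suc_eq_le)
  define h where "h i = (if indet i \<in> D then g i else g i + N)" for i
  have "inj h"
  proof (rule injI)
    fix i j assume "h i = h j"
    then have "g i = g j" using N[of i] N[of j] by (auto simp: h_def split: if_splits)
    then show "i = j" using g by (auto dest: injD)
  qed
  moreover have "h i \<le> h j" if "indet i \<in> D" "indet j \<notin> D" for i j
    using that N[of i] by (simp add: h_def)
  ultimately show ?thesis
    using term_ordering_lex[of h] indet_lex_ordering_le[of h]
    by (intro exI[of _ "lex_ordering h"]) (auto simp: indets_def)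
qed

section \<open>Selections from disjoint sets\<close>

lemma leading_set_eq:
  assumes "term_ordering \<sigma>" "z \<in> C" "\<forall>y\<in>C. (z, y) \<in> \<sigma>"
  shows "leading_set \<sigma> C = C - {z}"
proof -
  have "(THE x. x \<in> C \<and> (\<forall>y\<in>C. (x, y) \<in> \<sigma>)) = z"
    using assms term_ordering_antisym[OF assms(1)] by (intro the_equality) auto
  then show ?thesis by (simp add: leading_set_def)
qed

lemma leading_set_exists:
  assumes "term_ordering \<sigma>" "finite C" "C \<noteq> {}"
  obtains z where "z \<in> C" "\<forall>y\<in>C. (z, y) \<in> \<sigma>" "leading_set \<sigma> C = C - {z}"
  using term_ordering_min[OF assms] leading_set_eq[OF assms(1)] by blast

text \<open>Index 0 stands for the trivial class, which may be empty; the indices from 1 to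
  \<open>q\<close> stand for the proper classes.\<close>

locale class_family =
  fixes q :: nat and E :: "nat \<Rightarrow> 'a set"
  assumes finite_class: "i \<le> q \<Longrightarrow> finite (E i)"
    and disjoint: "i \<le> q \<Longrightarrow> j \<le> q \<Longrightarrow> i \<noteq> j \<Longrightarrow> E i \<inter> E j = {}"
    and nonempty: "i \<in> {1..q} \<Longrightarrow> E i \<noteq> {}"
begin

definition selection :: "(nat \<Rightarrow> 'a) \<Rightarrow> 'a set" where
  "selection x = E 0 \<union> (\<Union>i\<in>{1..q}. E i - {x i})"

text \<open>The union is disjoint and each of the \<open>q\<close> classes loses exactly one
  element. The integers avoid truncated subtraction.\<close>

lemma card_selection:
  assumes "\<And>i. i \<in> {1..q} \<Longrightarrow> x i \<in> E i"
  shows "int (card (selection x)) = int (card (E 0)) + (\<Sum>i\<in>{1..q}. int (card (E i))) - int q"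
proof -
  have "card (selection x) = card (E 0) + card (\<Union>i\<in>{1..q}. E i - {x i})"
    unfolding selection_def
  proof (rule card_Un_disjoint)
    show "E 0 \<inter> (\<Union>i\<in>{1..q}. E i - {x i}) = {}" using disjoint[of 0] by fastforce
  qed (use finite_class in auto)
  also have "card (\<Union>i\<in>{1..q}. E i - {x i}) = (\<Sum>i\<in>{1..q}. card (E i - {x i}))"
  proof (rule card_UN_disjoint)
    show "\<forall>i\<in>{1..q}. \<forall>j\<in>{1..q}. i \<noteq> j \<longrightarrow> (E i - {x i}) \<inter> (E j - {x j}) = {}"
      using disjoint by fastforce
  qed (use finite_class in auto)
  also have "int (card (E 0) + \<dots>) = int (card (E 0)) + (\<Sum>i\<in>{1..q}. int (card (E i)) - 1)"
  proof -
    have "int (card (E i - {x i})) = int (card (E i)) - 1" if "i \<in> {1..q}" for i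
      using that assms[OF that] finite_class[of i] nonempty[OF that] card_gt_0_iff[of "E i"]
      by (simp add: card_Diff_singleton of_nat_diff)
    then show ?thesis by simp
  qed
  finally show ?thesis by (simp add: sum_subtractf)
qed

lemma selection_eq_iff_mem:
  assumes "i \<in> {1..q}" "\<And>i. i \<in> {1..q} \<Longrightarrow> x i \<in> E i" "y \<in> E i"
  shows "y \<in> selection x \<longleftrightarrow> y \<noteq> x i"
  using assms disjoint[of i] unfolding selection_def by fastforce

text \<open>By disjointness, \<open>x i\<close> is the only element of \<open>E i\<close> missing
  from the selection, so it can be read off. Extensionality of the functions in \<open>PiE\<close>
  fixes the values outside the index range.\<close>

lemma inj_on_selection: "inj_on selection (PiE {1..q} E)"
proof (rule inj_onI)
  fix x y assume x: "x \<in> PiE {1..q} E" and y: "y \<in> PiE {1..q} E" and eq: "selection x = selection y"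
  have xE: "x i \<in> E i" and yE: "y i \<in> E i" if "i \<in> {1..q}" for i
    using x y that by (auto simp: PiE_iff)
  have "x i = y i" if i: "i \<in> {1..q}" for i
    using selection_eq_iff_mem[where x=x, OF i xE xE[OF i]] selection_eq_iff_mem[where x=y, OF i yE xE[OF i]] eq
    by simp
  with x y show "x = y" by (intro PiE_ext)
qed

lemma selections_eq:
  "{E 0 \<union> (\<Union>i\<in>{1..q}. Estar i) | Estar. \<forall>i\<in>{1..q}. \<exists>x\<in>E i. Estar i = E i - {x}} =
    selection ` PiE {1..q} E"
proof (intro equalityI subsetI)
  fix T assume "T \<in> {E 0 \<union> (\<Union>i\<in>{1..q}. Estar i) | Estar. \<forall>i\<in>{1..q}. \<exists>x\<in>E i. Estar i = E i - {x}}"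
  then obtain Estar where T: "T = E 0 \<union> (\<Union>i\<in>{1..q}. Estar i)"
    and "\<forall>i\<in>{1..q}. \<exists>x\<in>E i. Estar i = E i - {x}"
    unfolding mem_Collect_eq by (elim exE conjE)
  from bchoice[OF this(2)[unfolded Bex_def]] obtain x where x: "\<forall>i\<in>{1..q}. x i \<in> E i \<and> Estar i = E i - {x i}" by blast
  then have "T = selection (restrict x {1..q})" by (simp add: T selection_def)
  moreover have "restrict x {1..q} \<in> PiE {1..q} E" using x by simp
  ultimately show "T \<in> selection ` PiE {1..q} E" by blast
next
  fix T assume "T \<in> selection ` PiE {1..q} E"
  then obtain x where x: "x \<in> PiE {1..q} E" and T: "T = selection x" by (elim imageE)
  then show "T \<in> {E 0 \<union> (\<Union>i\<in>{1..q}. Estar i) | Estar. \<forall>i\<in>{1..q}. \<exists>x\<in>E i. Estar i = E i - {x}}"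
    unfolding mem_Collect_eq
  proof (intro exI[of _ "\<lambda>i. E i - {x i}"] conjI ballI)
    fix i assume "i \<in> {1..q}"
    with x show "\<exists>y\<in>E i. E i - {x i} = E i - {y}" by (intro bexI[of _ "x i"]) auto
  qed (simp add: T selection_def)
qed

lemma card_selections: "card (selection ` PiE {1..q} E) = (\<Prod>i\<in>{1..q}. card (E i))"
  by (simp only: card_image[OF inj_on_selection] card_PiE finite_atLeastAtMost)

end

section \<open>The cotangent equivalence classes\<close>

lemma trivial_class_eq:
  assumes "ideal I poly_ring" "I \<subseteq> max_ideal"
  shows "trivial_class I = {indet i | i. indet_poly i \<in> Lin I}"
  using trivial_indet_iff[OF assms] by (auto simp: trivial_class_def indets_def)

text \<open>Triviality is constant on a class, so it may be tested at \<open>i\<close>; having at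
  least two elements means that \<open>i\<close> has a partner other than itself.\<close>

lemma (in two_term_span) proper_classes_eq:
  assumes I: "ideal I poly_ring" "I \<subseteq> max_ideal" and L: "Lin I = L"
  shows "proper_classes I =
    {indet ` {j. cotangent_rel L i j} | i. indet_poly i \<notin> L \<and> (\<exists>j. j \<noteq> i \<and> cotangent_rel L i j)}"
proof -
  have cls: "cot_equiv I `` {indet i} = indet ` {j. cotangent_rel L i j}" for i
  proof -
    have "cot_equiv I `` {indet i} \<subseteq> indets" by (auto simp: cot_equiv_def)
    then show ?thesis
      using cot_equiv_indet_iff[OF I, of i] unfolding L cotangent_rel_def[symmetric]
      by (auto simp: indets_def)
  qed
  have quot: "indets // cot_equiv I = (\<lambda>i. indet ` {j. cotangent_rel L i j}) ` UNIV"
    unfolding quotient_def by (auto simp: indets_def cls)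
  have triv: "(\<forall>x\<in>indet ` {j. cotangent_rel L i j}. \<not> trivial_indet I x) \<longleftrightarrow> indet_poly i \<notin> L" for i
    using indet_in_L_iff_of_rel cotangent_rel_refl by (auto simp: trivial_indet_iff[OF I] L)
  have card: "2 \<le> card (indet ` {j. cotangent_rel L i j}) \<longleftrightarrow> (\<exists>j. j \<noteq> i \<and> cotangent_rel L i j)" for i
  proof -
    have "card (indet ` {j. cotangent_rel L i j}) = card {j. cotangent_rel L i j}"
      by (rule card_image) (rule inj_on_subset[OF inj_indet subset_UNIV])
    moreover have "card {j. cotangent_rel L i j} \<le> Suc 0 \<longleftrightarrow> (\<forall>j. cotangent_rel L i j \<longrightarrow> j = i)"
      using cotangent_rel_refl by (auto simp: card_le_Suc0_iff_eq)
    moreover have "2 \<le> n \<longleftrightarrow> \<not> n \<le> Suc 0" for n :: nat by auto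
    ultimately show ?thesis by auto
  qed
  have "proper_classes I = {indet ` {j. cotangent_rel L i j} | i.
      (\<forall>x\<in>indet ` {j. cotangent_rel L i j}. \<not> trivial_indet I x) \<and>
      2 \<le> card (indet ` {j. cotangent_rel L i j})}"
    unfolding proper_classes_def quot by blast
  then show ?thesis by (simp only: triv card)
qed

text \<open>A non-trivial indeterminate with a smaller equivalent one lies in a proper class and is
  not its minimum, and conversely.\<close>

lemma (in two_term_span) leading_indets_eq:
  assumes \<sigma>: "term_ordering \<sigma>"
    and I: "ideal I poly_ring" "I \<subseteq> max_ideal" and L: "Lin I = L"
  shows "leading_indets \<sigma> L = trivial_class I \<union> (\<Union>C\<in>proper_classes I. leading_set \<sigma> C)"
proof (intro equalityI subsetI)
  note classes = proper_classes_eq[OF I L] trivial_class_eq[OF I, unfolded L]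
  fix x assume "x \<in> leading_indets \<sigma> L"
  then obtain i where x: "x = indet i"
    and i: "indet_poly i \<in> L \<or> (\<exists>j. j \<noteq> i \<and> cotangent_rel L i j \<and> (indet j, indet i) \<in> \<sigma>)"
    by (auto simp: leading_indets_def)
  show "x \<in> trivial_class I \<union> (\<Union>C\<in>proper_classes I. leading_set \<sigma> C)"
  proof (cases "indet_poly i \<in> L")
    case True
    then show ?thesis by (auto simp: classes x)
  next
    case False
    with i obtain j where j: "j \<noteq> i" "cotangent_rel L i j" "(indet j, indet i) \<in> \<sigma>" by blast
    define C where "C = indet ` {j. cotangent_rel L i j}"
    have C: "C \<in> proper_classes I" using False j by (auto simp: classes C_def)
    have mem: "x \<in> C" "indet j \<in> C" using j cotangent_rel_refl by (auto simp: C_def x)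
    obtain z where z: "z \<in> C" "\<forall>y\<in>C. (z, y) \<in> \<sigma>" "leading_set \<sigma> C = C - {z}"
      using leading_set_exists[OF \<sigma>, of C] mem by (auto simp: C_def)
    have "x \<noteq> z"
      using z mem j term_ordering_antisym[OF \<sigma> j(3)] by (auto simp: x)
    with z mem C show ?thesis by blast
  qed
next
  note classes = proper_classes_eq[OF I L] trivial_class_eq[OF I, unfolded L]
  fix x assume "x \<in> trivial_class I \<union> (\<Union>C\<in>proper_classes I. leading_set \<sigma> C)"
  then consider "x \<in> trivial_class I" | C where "C \<in> proper_classes I" "x \<in> leading_set \<sigma> C" by blast
  then show "x \<in> leading_indets \<sigma> L"
  proof cases
    case 1
    then show ?thesis by (auto simp: classes leading_indets_def)
  next
    case 2
    then obtain k where C: "C = indet ` {j. cotangent_rel L k j}" by (auto simp: classes)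
    then have "finite C" "C \<noteq> {}" using cotangent_rel_refl by auto
    then obtain z where z: "z \<in> C" "\<forall>y\<in>C. (z, y) \<in> \<sigma>" "leading_set \<sigma> C = C - {z}"
      using leading_set_exists[OF \<sigma>] by metis
    from z 2(2) have "x \<in> C" "x \<noteq> z" by auto
    with z C obtain i j where "x = indet i" "z = indet j" "cotangent_rel L k i" "cotangent_rel L k j"
      by auto
    moreover from this have "cotangent_rel L i j"
      using cotangent_rel_trans cotangent_rel_sym by blast
    ultimately show ?thesis using z \<open>x \<in> C\<close> \<open>x \<noteq> z\<close> by (auto simp: leading_indets_def)
  qed
qed

text \<open>Proper classes avoid the trivial one because triviality is constant on classes, and
  overlapping classes coincide; injectivity of \<open>E\<close> then separates different
  indices.\<close>

lemma (in two_term_span) class_family_cotangent: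
  assumes I: "ideal I poly_ring" "I \<subseteq> max_ideal" and L: "Lin I = L"
    and E_trivial: "E 0 = trivial_class I"
    and E_proper: "bij_betw E {1..q} (proper_classes I)"
  shows "class_family q E"
proof -
  note classes = proper_classes_eq[OF I L] trivial_class_eq[OF I, unfolded L]
  have E: "\<exists>k. E i = indet ` {j. cotangent_rel L k j} \<and> indet_poly k \<notin> L" if "i \<in> {1..q}" for i
  proof -
    have "E i \<in> proper_classes I" using bij_betwE[OF E_proper] that by blast
    then show ?thesis by (auto simp: classes)
  qed
  have d0: "E 0 \<inter> E i = {}" if i: "i \<in> {1..q}" for i
    using E[OF i] indet_in_L_iff_of_rel by (auto simp: E_trivial classes)
  have dd: "E i \<inter> E j = {}" if i: "i \<in> {1..q}" and j: "j \<in> {1..q}" and "i \<noteq> j" for i j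
  proof (rule ccontr)
    assume ne: "E i \<inter> E j \<noteq> {}"
    obtain k m where k: "E i = indet ` {j. cotangent_rel L k j}" and m: "E j = indet ` {j. cotangent_rel L m j}"
      using E[OF i] E[OF j] by blast
    with ne obtain n where "cotangent_rel L k n" "cotangent_rel L m n" by auto
    then have "cotangent_rel L k = cotangent_rel L m"
      using cotangent_rel_trans cotangent_rel_sym by blast
    then have "E i = E j" by (simp add: k m)
    with E_proper i j \<open>i \<noteq> j\<close> show False by (auto simp: bij_betw_def dest: inj_onD)
  qed
  show ?thesis
  proof
    fix i j assume ij: "i \<le> q" "j \<le> q" "i \<noteq> j"
    consider "i = 0" "j \<in> {1..q}" | "j = 0" "i \<in> {1..q}" | "i \<in> {1..q}" "j \<in> {1..q}"
      using ij by fastforce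
    then show "E i \<inter> E j = {}"
      using ij(3) d0 dd by cases (blast+)
  next
    fix i assume "i \<le> q"
    then show "finite (E i)"
    proof (cases "i = 0")
      case True
      then show ?thesis by (simp add: E_trivial classes)
    next
      case False
      with \<open>i \<le> q\<close> show ?thesis using E[of i] by auto
    qed
  next
    fix i assume "i \<in> {1..q}"
    then show "E i \<noteq> {}" using E[of i] cotangent_rel_refl by auto
  qed
qed


section \<open>Deriving the four claims from normal forms and selections\<close>

theorem theorem5p5:
  fixes f :: "nat \<Rightarrow> ('n::finite, 'k::field) mpoly"
    and r q :: nat
    and I I\<^sub>L :: "('n, 'k) mpoly set"
    and E :: "nat \<Rightarrow> 'n trm set"
    and S :: "'n trm_rel \<Rightarrow> 'n trm set"
    and Sig :: "'n trm set set"
  assumes f_max: "\<forall>i\<in>{1..r}. f i \<in> max_ideal"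
    and f_lin: "\<forall>i\<in>{1..r}. \<exists>a b i1 i2. lin (f i) = const_poly a * indet_poly i1 + const_poly b * indet_poly i2"
    and I_eq: "I = ideal_gen (f ` {1..r})"
    and I\<^sub>L_eq: "I\<^sub>L = lin_ideal I"
    and E_trivial: "E 0 = trivial_class I"
    and E_proper: "bij_betw E {1..q} (proper_classes I)"
    and S_eq: "S = (\<lambda>\<sigma>. S_set \<sigma> I\<^sub>L)"
    and Sig_eq: "Sig = {E 0 \<union> (\<Union>i\<in>{1..q}. Estar i) | Estar.
                          \<forall>i\<in>{1..q}. \<exists>x\<in>E i. Estar i = E i - {x}}"
  shows
    "(\<forall>\<sigma>. term_ordering \<sigma> \<longrightarrow>
        S \<sigma> = E 0 \<union> (\<Union>i\<in>{1..q}. leading_set \<sigma> (E i)) \<and>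
        int (card (S \<sigma>)) = int (card (E 0)) + (\<Sum>i\<in>{1..q}. int (card (E i))) - int q)
     \<and>
     (\<forall>Estar. (\<forall>i\<in>{1..q}. \<exists>x\<in>E i. Estar i = E i - {x}) \<longrightarrow>
        (\<exists>\<sigma>. term_ordering \<sigma> \<and> S \<sigma> = E 0 \<union> (\<Union>i\<in>{1..q}. Estar i)))
     \<and>
     (LTGFan I\<^sub>L = {S \<sigma> | \<sigma>. term_ordering \<sigma>} \<and>
      (\<exists>\<phi>. (\<forall>\<sigma>. term_ordering \<sigma> \<longrightarrow> \<phi> (S \<sigma>) = E 0 \<union> (\<Union>i\<in>{1..q}. leading_set \<sigma> (E i))) \<and>
           bij_betw \<phi> (LTGFan I\<^sub>L) Sig))
     \<and>
     (card (LTGFan I\<^sub>L) = card (GFan I\<^sub>L) \<and>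
      card (GFan I\<^sub>L) = (\<Prod>i\<in>{1..q}. card (E i)))"
proof -
  have F_max: "f ` {1..r} \<subseteq> max_ideal" using f_max by auto
  have I: "ideal I poly_ring" unfolding I_eq by (rule ideal_ideal_gen)
  have I_max: "I \<subseteq> max_ideal"
    unfolding I_eq by (rule ideal_gen_minimal[OF _ F_max]) (simp add: max_ideal_def ideal_ideal_gen)
  define L where "L = Lin I"
  have L: "Lin I = L" by (simp add: L_def)
  interpret two_term_span L "lin ` f ` {1..r}"
  proof
    show "L = K_span (lin ` f ` {1..r})"
      unfolding L_def I_eq by (rule Lin_ideal_gen[OF F_max])
    fix p assume "p \<in> lin ` f ` {1..r}"
    then obtain i where "i \<in> {1..r}" "p = lin (f i)" by auto
    with f_lin show "\<exists>a b i j. p = const_poly a * indet_poly i + const_poly b * indet_poly j"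
      by simp
  qed
  interpret class_family q E
    by (rule class_family_cotangent[OF I I_max L E_trivial E_proper])
  have I\<^sub>L: "I\<^sub>L = ideal_gen L" by (simp add: I\<^sub>L_eq lin_ideal_def L)
  have classes: "E ` {1..q} = proper_classes I" using E_proper by (simp add: bij_betw_def)
  have S_leading: "S \<sigma> = leading_indets \<sigma> L" if "term_ordering \<sigma>" for \<sigma>
  proof -
    interpret two_term_order L "lin ` f ` {1..r}" \<sigma> by unfold_locales (rule that)
    show ?thesis by (simp only: S_eq I\<^sub>L S_set_eq)
  qed
  have a: "S \<sigma> = E 0 \<union> (\<Union>i\<in>{1..q}. leading_set \<sigma> (E i))" if \<sigma>: "term_ordering \<sigma>" for \<sigma>
    unfolding S_leading[OF \<sigma>] leading_indets_eq[OF \<sigma> I I_max L] E_trivial classes[symmetric]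
    by (simp only: image_image)
  have lead: "\<exists>z. z \<in> E i \<and> leading_set \<sigma> (E i) = E i - {z}"
    if "term_ordering \<sigma>" "i \<in> {1..q}" for \<sigma> i
  proof -
    have "finite (E i)" using that(2) by (simp add: finite_class)
    from leading_set_exists[OF that(1) this nonempty[OF that(2)]] show ?thesis by metis
  qed
  have a_card: "int (card (S \<sigma>)) = int (card (E 0)) + (\<Sum>i\<in>{1..q}. int (card (E i))) - int q"
    if \<sigma>: "term_ordering \<sigma>" for \<sigma>
  proof -
    have "\<forall>i\<in>{1..q}. \<exists>z. z \<in> E i \<and> leading_set \<sigma> (E i) = E i - {z}" using lead[OF \<sigma>] by blast
    from bchoice[OF this]
    obtain z where z: "\<forall>i\<in>{1..q}. z i \<in> E i \<and> leading_set \<sigma> (E i) = E i - {z i}" by blast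
    then have "S \<sigma> = selection z" by (simp add: a[OF \<sigma>] selection_def)
    with z show ?thesis by (simp only: card_selection)
  qed
  have b: "\<exists>\<sigma>. term_ordering \<sigma> \<and> S \<sigma> = E 0 \<union> (\<Union>i\<in>{1..q}. Estar i)"
    if "\<forall>i\<in>{1..q}. \<exists>x\<in>E i. Estar i = E i - {x}" for Estar
  proof -
    from bchoice[OF that[unfolded Bex_def]]
    obtain x where x: "\<forall>i\<in>{1..q}. x i \<in> E i \<and> Estar i = E i - {x i}" by blast
    \<comment> \<open>The elements to be deleted are placed below all other indeterminates, so that
      each becomes the least element of its class.\<close>
    obtain \<sigma> :: "'n trm_rel" where \<sigma>: "term_ordering \<sigma>"
      and below: "\<forall>s\<in>x ` {1..q} \<inter> indets. \<forall>t\<in>indets - x ` {1..q}. (s, t) \<in> \<sigma>"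
      using term_ordering_below by blast
    have "leading_set \<sigma> (E i) = Estar i" if i: "i \<in> {1..q}" for i
    proof -
      have "E i \<in> proper_classes I" using classes i by blast
      then have sub: "E i \<subseteq> indets"
        by (auto simp: proper_classes_eq[OF I I_max L] indets_def)
      have "(x i, y) \<in> \<sigma>" if y: "y \<in> E i" for y
      proof (cases "y = x i")
        case False
        \<comment> \<open>Disjointness ensures that \<open>y\<close> is not the element chosen in
          another class, so \<open>y\<close> lies above \<open>x i\<close>.\<close>
        have "y \<notin> x ` {1..q}"
        proof
          assume "y \<in> x ` {1..q}"
          then obtain j where j: "j \<in> {1..q}" "y = x j" by blast
          then have "y \<in> E i \<inter> E j" "i \<noteq> j" using x y False by auto
          with disjoint[of i j] i j show False by auto
        qed
        with below sub y x i show ?thesis by blast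
      qed (simp add: term_ordering_refl[OF \<sigma>])
      with x i show ?thesis using leading_set_eq[OF \<sigma>, of "x i" "E i"] by simp
    qed
    then have "S \<sigma> = E 0 \<union> (\<Union>i\<in>{1..q}. Estar i)" by (simp add: a[OF \<sigma>])
    with \<sigma> show ?thesis by blast
  qed
  have fan: "LTGFan I\<^sub>L = {S \<sigma> | \<sigma>. term_ordering \<sigma>}"
    unfolding I\<^sub>L LTGFan_eq using S_leading by force
  have fan_Sig: "LTGFan I\<^sub>L = Sig"
  proof
    show "LTGFan I\<^sub>L \<subseteq> Sig"
    proof
      fix T assume "T \<in> LTGFan I\<^sub>L"
      then obtain \<sigma> where \<sigma>: "term_ordering \<sigma>" "T = S \<sigma>" by (auto simp: fan)
      then show "T \<in> Sig"
        unfolding Sig_eq mem_Collect_eq a[OF \<sigma>(1)] \<sigma>(2) using lead[OF \<sigma>(1)]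
        by (intro exI[of _ "\<lambda>i. leading_set \<sigma> (E i)"]) blast
    qed
    show "Sig \<subseteq> LTGFan I\<^sub>L"
    proof
      fix T assume "T \<in> Sig"
      then obtain Estar where T: "T = E 0 \<union> (\<Union>i\<in>{1..q}. Estar i)"
        and "\<forall>i\<in>{1..q}. \<exists>x\<in>E i. Estar i = E i - {x}"
        unfolding Sig_eq mem_Collect_eq by (elim exE conjE)
      from b[OF this(2)] obtain \<sigma> where "term_ordering \<sigma>" "T = S \<sigma>" unfolding T by metis
      then show "T \<in> LTGFan I\<^sub>L" by (auto simp: fan)
    qed
  qed
  have "\<exists>\<phi>. (\<forall>\<sigma>. term_ordering \<sigma> \<longrightarrow> \<phi> (S \<sigma>) = E 0 \<union> (\<Union>i\<in>{1..q}. leading_set \<sigma> (E i))) \<and>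
      bij_betw \<phi> (LTGFan I\<^sub>L) Sig"
    \<comment> \<open>By (a) the prescribed value at \<open>S \<sigma>\<close> is
      \<open>S \<sigma>\<close> itself, so the identity serves as the map and bijectivity reduces to
      the equality of the two sets.\<close>
    using a fan_Sig by (intro exI[of _ id]) simp
  moreover have card: "card (LTGFan I\<^sub>L) = card (GFan I\<^sub>L)"
    unfolding I\<^sub>L by (rule card_LTGFan_eq)
  moreover have "card (GFan I\<^sub>L) = (\<Prod>i\<in>{1..q}. card (E i))"
    by (simp only: card[symmetric] fan_Sig Sig_eq selections_eq card_selections)
  ultimately show ?thesis
    using fan by (intro conjI allI impI a a_card b)
qed

end
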